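(* Let $\mathcal T$ be a full subcategory of the category of topological spaces and continuous maps such that $I=[0,1]\in\mathrm{Ob}(\mathcal T)$, and let $(F,i)$ be a minimal functor of a free topological group on $\mathcal T$. Suppose that $X\in\mathrm{Ob}(\mathcal T)$ is a metrizable separable space that has a compactification $\bar X\in\mathrm{Ob}(\mathcal T)$. If $FX$ is a $k$-space, then $X$ is locally compact or scattered.
   Context: Topological groups are assumed to be Hausdorff. A subcategory $\mathcal T$ of the category of topological spaces is full if every continuous map between objects of $\mathcal T$ is a morphism of $\mathcal T$. A functor of a free topological group on $\mathcal T$ is a pair $(F,i)$ consisting of a covariant functor $F$ from $\mathcal T$ to the category of topological groups and continuous homomorphisms, and a natural family $i=\{i_X\}$ of topological embeddings $i_X:X\to FX$, $X\in\mathrm{Ob}(\mathcal T)$; naturality means $Ff\circ i_X=i_Y\circ f$ for every morphism $f:X\to Y$ of $\mathcal T$. It is minimal if for every $X\in\mathrm{Ob}(\mathcal T)$ the group $FX$ is algebraically generated by $i_X(X)$. A compactification of $X$ is a compact Hausdorff space containing $X$ as a dense subspace. A topological space is scattered if every non-empty subspace of it has an isolated point (of that subspace). A Hausdorff space is a $k$-space if a subset is closed whenever its intersection with every compact subset is closed. *)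

theory Defs
  imports "HOL-Analysis.Analysis" "HOL-Algebra.Generated_Groups"
begin

definition scattered_space :: "'a topology \<Rightarrow> bool" where
  "scattered_space X \<longleftrightarrow>
     (\<forall>S. S \<subseteq> topspace X \<and> S \<noteq> {} \<longrightarrow> (\<exists>x\<in>S. openin (subtopology X S) {x}))"

text \<open>
  As all spaces of a category have to live on one type, a compactification of \<open>X\<close> is taken
  together with the dense embedding \<open>e\<close> of \<open>X\<close> in it; the case of a literal
  superspace is \<open>e = id\<close>.
\<close>

definition compactification :: "'a topology \<Rightarrow> 'c topology \<Rightarrow> ('a \<Rightarrow> 'c) \<Rightarrow> bool" where
  "compactification X Y e \<longleftrightarrow>
     compact_space Y \<and> Hausdorff_space Y \<and> embedding_map X Y e \<and>
     Y closure_of (e ` topspace X) = topspace Y"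

record 'a topgroup = "'a monoid" +
  gtop :: "'a topology"

locale topological_group = group G for G :: "'a topgroup" (structure) +
  assumes topspace_gtop: "topspace (gtop G) = carrier G"
    and continuous_mult:
      "continuous_map (prod_topology (gtop G) (gtop G)) (gtop G) (\<lambda>(x, y). x \<otimes> y)"
    and continuous_inv: "continuous_map (gtop G) (gtop G) (\<lambda>x. inv x)"
    and Hausdorff: "Hausdorff_space (gtop G)"

text \<open>
  Continuous maps are made extensional, so that two HOL functions that agree on the
  domain are the same morphism.  A full subcategory of the category of topological spaces
  is then determined by its set of objects \<open>Ob\<close>, its morphisms from \<open>X\<close> to
  \<open>Y\<close> being all of \<open>top_hom X Y\<close>.
\<close>

definition top_hom :: "'a topology \<Rightarrow> 'c topology \<Rightarrow> ('a \<Rightarrow> 'c) set" where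
  "top_hom X Y = {f. continuous_map X Y f \<and> f \<in> extensional (topspace X)}"

text \<open>
  \<open>Fm X Y f\<close> is the image under the functor of the morphism \<open>f\<close> from
  \<open>X\<close> to \<open>Y\<close>; only its values on the carrier of \<open>F X\<close> matter.
\<close>

locale functor_to_topological_groups =
  fixes Ob :: "'a topology set"
    and F :: "'a topology \<Rightarrow> 'b topgroup"
    and Fm :: "'a topology \<Rightarrow> 'a topology \<Rightarrow> ('a \<Rightarrow> 'a) \<Rightarrow> 'b \<Rightarrow> 'b"
  assumes F_object: "X \<in> Ob \<Longrightarrow> topological_group (F X)"
    and Fm_hom: "\<lbrakk>X \<in> Ob; Y \<in> Ob; f \<in> top_hom X Y\<rbrakk> \<Longrightarrow> Fm X Y f \<in> hom (F X) (F Y)"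
    and Fm_continuous: "\<lbrakk>X \<in> Ob; Y \<in> Ob; f \<in> top_hom X Y\<rbrakk>
      \<Longrightarrow> continuous_map (gtop (F X)) (gtop (F Y)) (Fm X Y f)"
    and Fm_id: "\<lbrakk>X \<in> Ob; u \<in> carrier (F X)\<rbrakk>
      \<Longrightarrow> Fm X X (restrict id (topspace X)) u = u"
    and Fm_compose: "\<lbrakk>X \<in> Ob; Y \<in> Ob; Z \<in> Ob; f \<in> top_hom X Y; g \<in> top_hom Y Z;
        u \<in> carrier (F X)\<rbrakk>
      \<Longrightarrow> Fm X Z (compose (topspace X) g f) u = Fm Y Z g (Fm X Y f u)"

locale free_topological_group_functor =
  functor_to_topological_groups Ob F Fm
  for Ob :: "'a topology set"
    and F :: "'a topology \<Rightarrow> 'b topgroup"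
    and Fm :: "'a topology \<Rightarrow> 'a topology \<Rightarrow> ('a \<Rightarrow> 'a) \<Rightarrow> 'b \<Rightarrow> 'b" +
  fixes i :: "'a topology \<Rightarrow> 'a \<Rightarrow> 'b"
  assumes i_embedding: "X \<in> Ob \<Longrightarrow> embedding_map X (gtop (F X)) (i X)"
    and i_natural: "\<lbrakk>X \<in> Ob; Y \<in> Ob; f \<in> top_hom X Y; x \<in> topspace X\<rbrakk>
      \<Longrightarrow> Fm X Y f (i X x) = i Y (f x)"

locale minimal_free_topological_group_functor =
  free_topological_group_functor Ob F Fm i
  for Ob :: "'a topology set"
    and F :: "'a topology \<Rightarrow> 'b topgroup"
    and Fm :: "'a topology \<Rightarrow> 'a topology \<Rightarrow> ('a \<Rightarrow> 'a) \<Rightarrow> 'b \<Rightarrow> 'b"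
    and i :: "'a topology \<Rightarrow> 'a \<Rightarrow> 'b" +
  assumes generated: "X \<in> Ob \<Longrightarrow> generate (F X) (i X ` topspace X) = carrier (F X)"

end

theory Submission
  imports Defs "HOL-Complex_Analysis.Complex_Analysis"
begin

text \<open>
  Suppose that the point \<open>a\<close> of \<open>X\<close> has no compact neighbourhood and that \<open>X\<close> is not scattered, so
  that there is a countable crowded set \<open>Q\<close> at positive distance from \<open>a\<close>.  Choose \<open>g : X \<rightarrow> [0,1]\<close>
  injective on \<open>Q\<close> and constant near \<open>a\<close>, and consider the words
  \<open>x\<^sub>1\<inverse> z\<^sub>1 x\<^sub>2\<inverse> z\<^sub>2 \<dots>\<close> with letters in \<open>Q\<close> whose intervals \<open>[g x\<^sub>k, g z\<^sub>k]\<close> are disjoint, increasing, of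
  total length at most \<open>1/2^n\<close>, and cover the first \<open>n\<close> points of \<open>g Q\<close>.  For each \<open>n\<close> the unit is a
  limit of such words.  If a compact set contained words \<open>w\<^sub>n\<close> for infinitely many \<open>n\<close>, then
  \<open>Fg (w\<^sub>n)\<close> would converge to the unit of \<open>F[0,1]\<close>, because collapsing the intervals is a small
  change of \<open>g\<close>; but a Cantor function \<open>f\<close> that is constant between the intervals of infinitely many
  levels makes the words telescope, so that \<open>F(f \<circ> g) (w\<^sub>n) = 0\<inverse> 1\<close>.  Multiplying the words of level
  \<open>n\<close> by the points of a closed discrete sequence within \<open>1/n\<close> of \<open>a\<close> hence yields a set that meets
  every compact set in a finite set and yet accumulates at \<open>a\<close>, so that \<open>FX\<close> is not a k-space.
\<close>

section \<open>Cantor functions\<close>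

text \<open>Division by \<open>m\<close> collapses blocks of \<open>m\<close> consecutive numbers.
  With \<open>m = 2 ^ k\<close> such a block is the set of descendants, \<open>k\<close> levels
  down, of one node of a binary tree.\<close>

lemma card_div_vimage:
  fixes m :: nat
  assumes "finite C" "m > 0"
  shows "finite {j. j div m \<in> C}" and "card {j. j div m \<in> C} = m * card C"
proof -
  have eq: "{j. j div m \<in> C} = (\<lambda>(c, k). c * m + k) ` (C \<times> {..<m})"
  proof
    show "{j. j div m \<in> C} \<subseteq> (\<lambda>(c, k). c * m + k) ` (C \<times> {..<m})"
    proof
      fix j assume "j \<in> {j. j div m \<in> C}"
      then have "j = (\<lambda>(c, k). c * m + k) (j div m, j mod m)" "(j div m, j mod m) \<in> C \<times> {..<m}"
        using assms by auto
      then show "j \<in> (\<lambda>(c, k). c * m + k) ` (C \<times> {..<m})" by blast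
    qed
    show "(\<lambda>(c, k). c * m + k) ` (C \<times> {..<m}) \<subseteq> {j. j div m \<in> C}"
      using assms by auto
  qed
  have "inj_on (\<lambda>(c, k). c * m + k) (C \<times> {..<m})"
  proof (rule inj_onI, clarsimp)
    fix c k c' k' assume kk: "k < m" "k' < m" "c * m + k = c' * m + k'"
    have d: "(c * m + k) div m = c" "(c' * m + k') div m = c'" using kk(1,2) by auto
    have "c = c'" by (rule trans[OF d(1)[symmetric]]) (subst kk(3), rule d(2))
    then show "c = c' \<and> k = k'" using kk(3) by simp
  qed
  then show "card {j. j div m \<in> C} = m * card C"
    unfolding eq by (subst card_image) (auto simp: card_cartesian_product)
  show "finite {j. j div m \<in> C}" unfolding eq using assms by auto
qed

text \<open>
  \<open>cf\<close> is the Cantor function that increases by \<open>1/2^s\<close> on each of the intervals \<open>[a s j, b s j]\<close>,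
  \<open>j < 2^s\<close>, for every level \<open>s\<close>, and is constant between them.
\<close>

locale interval_tree =
  fixes a b :: "nat \<Rightarrow> nat \<Rightarrow> real"
  assumes less: "j < 2 ^ s \<Longrightarrow> a s j < b s j"
    and succ: "Suc j < 2 ^ s \<Longrightarrow> b s j \<le> a s (Suc j)"
    and left: "j < 2 ^ s \<Longrightarrow> a s j \<le> a (Suc s) (2 * j)"
    and right: "j < 2 ^ s \<Longrightarrow> b (Suc s) (Suc (2 * j)) \<le> b s j"
begin

lemma sep: "b s j \<le> a s k" if "j < k" "k < 2 ^ s"
  using that
proof (induction k)
  case (Suc k)
  show ?case
  proof (cases "j = k")
    case True
    then show ?thesis using succ Suc.prems by simp
  next
    case False
    then have "b s j \<le> a s k" using Suc by simp
    also have "\<dots> \<le> b s k" using less[of k s] Suc.prems by simp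
    also have "\<dots> \<le> a s (Suc k)" using succ Suc.prems by simp
    finally show ?thesis .
  qed
qed simp

text \<open>The locale bounds only the outer ends of the children \<open>2 * k\<close> and
  \<open>Suc (2 * k)\<close>; the bounds on their inner ends follow because the children are
  nondegenerate and ordered.\<close>

lemma nested1: "a s (j div 2) \<le> a (Suc s) j \<and> b (Suc s) j \<le> b s (j div 2)" if "j < 2 ^ Suc s"
proof -
  have j: "j div 2 < 2 ^ s" using that by auto
  let ?k = "j div 2"
  have k: "Suc (2 * ?k) < 2 ^ Suc s" using j by simp
  have l: "a (Suc s) (2 * ?k) < b (Suc s) (2 * ?k)" using less[of "2 * ?k" "Suc s"] k by linarith
  have r: "a (Suc s) (Suc (2 * ?k)) < b (Suc s) (Suc (2 * ?k))" using less k by simp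
  have m: "b (Suc s) (2 * ?k) \<le> a (Suc s) (Suc (2 * ?k))" using succ k by blast
  have "j = 2 * ?k \<or> j = Suc (2 * ?k)" by presburger
  then show ?thesis
  proof
    assume e: "j = 2 * ?k"
    show ?thesis using left[OF j] right[OF j] l r m e by (smt (verit))
  next
    assume e: "j = Suc (2 * ?k)"
    show ?thesis using left[OF j] right[OF j] l r m e by (smt (verit))
  qed
qed

text \<open>\<open>j div 2 ^ k\<close> is the ancestor of node \<open>j\<close> that lies
  \<open>k\<close> levels higher.\<close>

lemma nested:
  "j < 2 ^ (s + k) \<Longrightarrow> a s (j div 2 ^ k) \<le> a (s + k) j \<and> b (s + k) j \<le> b s (j div 2 ^ k)"
proof (induction k arbitrary: j)
  case (Suc k)
  have j: "j < 2 ^ Suc (s + k)" using Suc.prems by simp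
  have j2: "j div 2 < 2 ^ (s + k)" using j by auto
  have "j div 2 div 2 ^ k = j div 2 ^ Suc k" by (simp add: div_mult2_eq)
  then show ?case using nested1[OF j] Suc.IH[OF j2] by force
qed simp

definition left_of :: "nat \<Rightarrow> real \<Rightarrow> nat set" where
  "left_of s y = {j. j < 2 ^ s \<and> b s j \<le> y}"

text \<open>These step functions approximate \<open>cf\<close> from below: they increase with the
  level, and \<open>step s\<close> stays within \<open>1 / 2 ^ s\<close> of the supremum.\<close>

definition step :: "nat \<Rightarrow> real \<Rightarrow> real" where
  "step s y = card (left_of s y) / 2 ^ s"

definition cf :: "real \<Rightarrow> real" where
  "cf y = (SUP s. step s y)"

lemma finite_left_of [simp]: "finite (left_of s y)"
  by (simp add: left_of_def)

lemma step_nonneg: "0 \<le> step s y"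
  by (simp add: step_def)

lemma step_le_1: "step s y \<le> 1"
proof -
  have "card (left_of s y) \<le> card {..<(2::nat) ^ s}"
    by (rule card_mono) (auto simp: left_of_def)
  then have "real (card (left_of s y)) \<le> 2 ^ s"
    by simp
  then show ?thesis by (simp add: step_def)
qed

text \<open>All \<open>2 ^ k\<close> descendants of an interval to the left of \<open>y\<close> are
  again to the left of \<open>y\<close>.\<close>

lemma step_mono: "step s y \<le> step (s + k) y"
proof -
  have "{j. j div 2 ^ k \<in> left_of s y} \<subseteq> left_of (s + k) y"
  proof
    fix j assume "j \<in> {j. j div 2 ^ k \<in> left_of s y}"
    then have j: "j div 2 ^ k < 2 ^ s" "b s (j div 2 ^ k) \<le> y" by (auto simp: left_of_def)
    then have "j < 2 ^ (s + k)"
      by (simp add: less_mult_imp_div_less power_add div_less_iff_less_mult)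
    then show "j \<in> left_of (s + k) y" using nested[of j s k] j by (auto simp: left_of_def)
  qed
  then have "2 ^ k * card (left_of s y) \<le> card (left_of (s + k) y)"
    using card_mono[OF finite_left_of] card_div_vimage(2)[of "left_of s y" "2 ^ k"]
    by (metis finite_left_of zero_less_numeral zero_less_power)
  then have "real (2 ^ k * card (left_of s y)) \<le> card (left_of (s + k) y)"
    using of_nat_le_iff by blast
  then show ?thesis by (simp add: step_def power_add field_simps)
qed

text \<open>An interval to the left of \<open>y\<close> has an ancestor beginning before
  \<open>y\<close>. At most one interval of level \<open>s\<close> begins before \<open>y\<close>
  and ends after it, and it accounts for the error \<open>1 / 2 ^ s\<close>.\<close>

lemma step_upper: "step (s + k) y \<le> step s y + 1 / 2 ^ s"
proof -
  define D where "D = {j. j < 2 ^ s \<and> a s j < y}"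
  have fin: "finite D" by (simp add: D_def)
  have "left_of (s + k) y \<subseteq> {j. j div 2 ^ k \<in> D}"
  proof
    fix j assume "j \<in> left_of (s + k) y"
    then have j: "j < 2 ^ (s + k)" "b (s + k) j \<le> y" by (auto simp: left_of_def)
    then have "j div 2 ^ k < 2 ^ s"
      by (simp add: less_mult_imp_div_less power_add)
    then show "j \<in> {j. j div 2 ^ k \<in> D}"
      using nested[OF j(1)] j less[OF j(1)] by (auto simp: D_def)
  qed
  then have "card (left_of (s + k) y) \<le> 2 ^ k * card D"
    using card_mono card_div_vimage[OF fin, of "2 ^ k"] by (metis zero_less_numeral zero_less_power)
  moreover have "card D \<le> card (left_of s y) + 1"
  proof -
    have one: "card (D - left_of s y) \<le> 1"
    proof -
      have "j = k" if "j \<in> D - left_of s y" "k \<in> D - left_of s y" for j k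
        using that sep[of j k s] sep[of k j s] by (auto simp: D_def left_of_def) (meson le_less_trans less_le_not_le linorder_neqE_nat linorder_not_less order_trans)+
      then show ?thesis by (metis card_le_Suc0_iff_eq One_nat_def fin finite_Diff)
    qed
    have "card D \<le> card (left_of s y \<union> (D - left_of s y))"
      by (rule card_mono) (use fin in auto)
    also have "\<dots> \<le> card (left_of s y) + card (D - left_of s y)" by (rule card_Un_le)
    finally show ?thesis using one by linarith
  qed
  ultimately have "card (left_of (s + k) y) \<le> 2 ^ k * (card (left_of s y) + 1)"
    by (meson le_trans mult_le_mono2)
  then have "real (card (left_of (s + k) y)) \<le> real (2 ^ k * (card (left_of s y) + 1))"
    using of_nat_le_iff by blast
  then show ?thesis by (simp add: step_def power_add field_simps)
qed

lemma step_le_cf: "step s y \<le> cf y"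
  unfolding cf_def by (rule cSUP_upper) (auto intro: bdd_aboveI2[where M = 1] step_le_1)

text \<open>Levels below \<open>s\<close> are dominated by later ones, so a comparison of values of
  \<open>cf\<close> may start at any convenient level.\<close>

lemma cf_le: "(\<And>k. step (s + k) y \<le> c) \<Longrightarrow> cf y \<le> c"
  unfolding cf_def
proof (rule cSUP_least)
  fix t assume c: "\<And>k. step (s + k) y \<le> c"
  have "step t y \<le> step (s + t) y" using step_mono[of t y s] by (simp add: add.commute)
  also have "\<dots> \<le> c" by (rule c)
  finally show "step t y \<le> c" .
qed simp

lemma cf_le_step: "cf y \<le> step s y + 1 / 2 ^ s"
  by (rule cf_le) (rule step_upper)

lemma cf_bounds: "0 \<le> cf y" "cf y \<le> 1"
  using step_nonneg step_le_cf order_trans apply blast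
  using cf_le[of 0] step_le_1 by auto

lemma cf_cong: "cf y = cf z" if "\<And>k. step (s + k) y = step (s + k) z"
  by (intro antisym cf_le[of s]) (use that step_le_cf in metis)+

lemma cf_eq_0: "cf y = 0" if "\<And>j. j < 2 ^ s \<Longrightarrow> y \<le> a s j"
proof -
  have "left_of (s + k) y = {}" for k
  proof -
    have "y < b (s + k) j" if j: "j < 2 ^ (s + k)" for j
    proof -
      have "j div 2 ^ k < 2 ^ s" using j by (simp add: less_mult_imp_div_less power_add)
      then show ?thesis using nested[OF j] less[OF j] \<open>\<And>j. j < 2 ^ s \<Longrightarrow> y \<le> a s j\<close> by fastforce
    qed
    then show ?thesis by (fastforce simp: left_of_def)
  qed
  then have "cf y \<le> 0" by (intro cf_le[of s]) (simp add: step_def)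
  then show ?thesis using cf_bounds[of y] by linarith
qed

lemma cf_eq_1: "cf y = 1" if "\<And>j. j < 2 ^ s \<Longrightarrow> b s j \<le> y"
proof -
  have "left_of s y = {..<2 ^ s}" using that by (auto simp: left_of_def)
  then have "step s y = 1" by (simp add: step_def)
  then show ?thesis using step_le_cf[of s y] cf_bounds[of y] by linarith
qed

text \<open>No interval of level \<open>s\<close> reaches into the gap between \<open>y\<close> and
  \<open>z\<close>, hence no descendant does, and from level \<open>s\<close> on the same intervals
  lie to the left of both points.\<close>

lemma cf_eq: "cf y = cf z" if "y \<le> z" "\<And>j. j < 2 ^ s \<Longrightarrow> b s j \<le> y \<or> z \<le> a s j"
proof (rule cf_cong)
  fix k
  have "left_of (s + k) y = left_of (s + k) z"
  proof -
    have "b (s + k) j \<le> y" if j: "j < 2 ^ (s + k)" and bz: "b (s + k) j \<le> z" for j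
    proof -
      have "j div 2 ^ k < 2 ^ s" using j by (simp add: less_mult_imp_div_less power_add)
      then show ?thesis
        using nested[OF j] less[OF j] \<open>\<And>j. j < 2 ^ s \<Longrightarrow> b s j \<le> y \<or> z \<le> a s j\<close> bz by fastforce
    qed
    then show ?thesis using \<open>y \<le> z\<close> by (auto simp: left_of_def)
  qed
  then show "step (s + k) y = step (s + k) z" by (simp add: step_def)
qed

lemma cf_mono: "y \<le> z \<Longrightarrow> cf y \<le> cf z"
proof (rule cf_le[of 0])
  fix k assume yz: "y \<le> z"
  have "card (left_of (0 + k) y) \<le> card (left_of (0 + k) z)"
    by (rule card_mono) (use yz in \<open>auto simp: left_of_def\<close>)
  then have "step (0 + k) y \<le> step (0 + k) z" by (simp add: step_def divide_right_mono)
  also have "\<dots> \<le> cf z" by (rule step_le_cf)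
  finally show "step (0 + k) y \<le> cf z" .
qed

text \<open>If two right ends of level \<open>s\<close> lay in \<open>(y, z]\<close>, the later
  interval would fit between \<open>y\<close> and \<open>z\<close> and be too short. So the count
  grows by at most one; the other \<open>1 / 2 ^ s\<close> is the error of
  \<open>step\<close>.\<close>

lemma cf_close: "cf z \<le> cf y + 2 / 2 ^ s" if "y \<le> z" "\<And>j. j < 2 ^ s \<Longrightarrow> z - y < b s j - a s j"
proof -
  have one: "card (left_of s z - left_of s y) \<le> 1"
  proof -
    have *: False if "j < k" "j \<in> left_of s z - left_of s y" "k \<in> left_of s z - left_of s y" for j k
      using that sep[of j k s] \<open>\<And>j. j < 2 ^ s \<Longrightarrow> z - y < b s j - a s j\<close>[of k]
      by (auto simp: left_of_def)
    then have "j = k" if "j \<in> left_of s z - left_of s y" "k \<in> left_of s z - left_of s y" for j k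
      using that by (meson linorder_neqE_nat)
    then show ?thesis by (metis card_le_Suc0_iff_eq One_nat_def finite_left_of finite_Diff)
  qed
  have "card (left_of s z) \<le> card (left_of s y \<union> (left_of s z - left_of s y))"
    by (rule card_mono) auto
  also have "\<dots> \<le> card (left_of s y) + card (left_of s z - left_of s y)" by (rule card_Un_le)
  finally have "card (left_of s z) \<le> card (left_of s y) + 1" using one by linarith
  then have "real (card (left_of s z)) \<le> real (card (left_of s y) + 1)" using of_nat_le_iff by blast
  then have "step s z \<le> step s y + 1 / 2 ^ s" by (simp add: step_def field_simps)
  moreover have "(2::real) / 2 ^ s = 1 / 2 ^ s + 1 / 2 ^ s" by simp
  ultimately show ?thesis using cf_le_step[of z s] step_le_cf[of s y] by linarith
qed

lemma continuous_cf: "continuous_on UNIV cf"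
  unfolding continuous_on_iff
proof (intro ballI allI impI)
  fix x and \<epsilon> :: real assume "\<epsilon> > 0"
  then obtain s where "(1 / 2) ^ s < \<epsilon> / 2"
    using real_arch_pow_inv[of "\<epsilon> / 2" "1 / 2"] by auto
  then have s: "2 / 2 ^ s < \<epsilon>" by (simp add: power_one_over field_simps)
  \<comment> \<open>The shortest length at level \<open>s\<close>, positive because the level is
    finite.\<close>
  define \<delta> where "\<delta> = Min ((\<lambda>j. b s j - a s j) ` {..<2 ^ s})"
  have ne: "{..<(2::nat) ^ s} \<noteq> {}" by (simp add: lessThan_empty_iff)
  have "\<delta> > 0" unfolding \<delta>_def using less ne by (subst Min_gr_iff) auto
  moreover have "dist (cf y) (cf x) < \<epsilon>" if "dist y x < \<delta>" for y
  proof -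
    have \<delta>: "\<delta> \<le> b s j - a s j" if "j < 2 ^ s" for j
      unfolding \<delta>_def using that by (intro Min_le) auto
    show ?thesis
    proof (cases "x \<le> y")
      case True
      have "cf y \<le> cf x + 2 / 2 ^ s"
        using True \<open>dist y x < \<delta>\<close> \<delta> by (intro cf_close) (force simp: dist_real_def)+
      then show ?thesis using cf_mono[OF True] s by (simp add: dist_real_def)
    next
      case False
      have "cf x \<le> cf y + 2 / 2 ^ s"
        using False \<open>dist y x < \<delta>\<close> \<delta> by (intro cf_close) (force simp: dist_real_def)+
      then show ?thesis using cf_mono[of y x] False s by (simp add: dist_real_def)
    qed
  qed
  ultimately show "\<exists>d>0. \<forall>x'\<in>UNIV. dist x' x < d \<longrightarrow> dist (cf x') (cf x) < \<epsilon>" by blast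
qed

end

text \<open>This splits a node of the tree. Crowdedness puts two distinct points of the sequence
  into \<open>(u, v)\<close>; for large \<open>n\<close> they are covered by members of
  \<open>S n\<close> that are too short to coincide or to leave \<open>[u, v]\<close>.\<close>

lemma two_subintervals:
  fixes S :: "nat \<Rightarrow> (real \<times> real) set" and e :: "nat \<Rightarrow> real"
  assumes crowded: "\<And>i \<epsilon>. \<epsilon> > 0 \<Longrightarrow> \<exists>k. e k \<noteq> e i \<and> \<bar>e k - e i\<bar> < \<epsilon>"
    and short: "\<And>n p. n \<in> N \<Longrightarrow> p \<in> S n \<Longrightarrow> fst p < snd p \<and> snd p - fst p \<le> (1 / 2) ^ n"
    and cover: "\<And>n i. n \<in> N \<Longrightarrow> i < n \<Longrightarrow> \<exists>p\<in>S n. fst p \<le> e i \<and> e i \<le> snd p"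
    and disj: "\<And>n p q. \<lbrakk>n \<in> N; p \<in> S n; q \<in> S n; p \<noteq> q\<rbrakk> \<Longrightarrow> snd p \<le> fst q \<or> snd q \<le> fst p"
    and k: "u < e k" "e k < v"
  shows "\<exists>m. \<forall>n\<ge>m. n \<in> N \<longrightarrow> (\<exists>p\<in>S n. \<exists>q\<in>S n. u \<le> fst p \<and> snd p \<le> fst q \<and> snd q \<le> v)"
proof -
  obtain k' where k': "e k' \<noteq> e k" "\<bar>e k' - e k\<bar> < min (e k - u) (v - e k)"
    using crowded[of "min (e k - u) (v - e k)" k] k by auto
  have "\<exists>i j. u < e i \<and> e i < e j \<and> e j < v"
  proof (cases "e k < e k'")
    case True
    then show ?thesis using k k' by (intro exI[of _ k] exI[of _ k']) auto
  next
    case False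
    then show ?thesis using k k' by (intro exI[of _ k'] exI[of _ k]) auto
  qed
  then obtain i j where ij: "u < e i" "e i < e j" "e j < v" by blast
  \<comment> \<open>An interval shorter than \<open>\<eta>\<close> that contains \<open>e i\<close>
    or \<open>e j\<close> crosses neither \<open>u\<close> nor \<open>v\<close> and cannot contain
    both points.\<close>
  define \<eta> where "\<eta> = min (min (e i - u) (v - e j)) (e j - e i)"
  have "\<eta> > 0" using ij by (simp add: \<eta>_def)
  then obtain m0 where m0: "(1 / 2) ^ m0 < \<eta>" using real_arch_pow_inv[of \<eta> "1 / 2"] by auto
  show ?thesis
  proof (intro exI[of _ "max m0 (Suc (max i j))"] allI impI)
    fix n assume n: "max m0 (Suc (max i j)) \<le> n" and "n \<in> N"
    have "(1 / 2) ^ n \<le> (1 / 2 :: real) ^ m0" using n by (intro power_decreasing) auto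
    then have small: "(1 / 2) ^ n < \<eta>" using m0 by linarith
    obtain p where p: "p \<in> S n" "fst p \<le> e i" "e i \<le> snd p" using cover[OF \<open>n \<in> N\<close>, of i] n by fastforce
    obtain q where q: "q \<in> S n" "fst q \<le> e j" "e j \<le> snd q" using cover[OF \<open>n \<in> N\<close>, of j] n by fastforce
    have sp: "snd p - fst p < \<eta>" "snd q - fst q < \<eta>"
      using short[OF \<open>n \<in> N\<close>] p q small by fastforce+
    then have "p \<noteq> q" using p q by (auto simp: \<eta>_def)
    then have "snd p \<le> fst q" using disj[OF \<open>n \<in> N\<close> p(1) q(1)] p q ij by linarith
    moreover have "u \<le> fst p" "snd q \<le> v" using sp p q by (auto simp: \<eta>_def)
    ultimately show "\<exists>p\<in>S n. \<exists>q\<in>S n. u \<le> fst p \<and> snd p \<le> fst q \<and> snd q \<le> v"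
      using p q by blast
  qed
qed

text \<open>Dependent choice selects increasing levels in \<open>N\<close> and, at the
  \<open>s\<close>-th of them, \<open>2 ^ s\<close> intervals forming level \<open>s\<close> of an
  \<open>interval_tree\<close>. \<open>M\<close> is the set of selected levels. Since
  \<open>cf\<close> can grow only on selected intervals, its properties hold relative to all of
  \<open>S n\<close>.\<close>

lemma cantor_function:
  fixes S :: "nat \<Rightarrow> (real \<times> real) set" and e :: "nat \<Rightarrow> real"
  assumes N: "infinite N"
    and crowded: "\<And>i \<epsilon>. \<epsilon> > 0 \<Longrightarrow> \<exists>k. e k \<noteq> e i \<and> \<bar>e k - e i\<bar> < \<epsilon>"
    and short: "\<And>n p. n \<in> N \<Longrightarrow> p \<in> S n \<Longrightarrow> fst p < snd p \<and> snd p - fst p \<le> (1 / 2) ^ n"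
    and inner: "\<And>n p. n \<in> N \<Longrightarrow> p \<in> S n \<Longrightarrow> \<exists>k. fst p < e k \<and> e k < snd p"
    and cover: "\<And>n i. n \<in> N \<Longrightarrow> i < n \<Longrightarrow> \<exists>p\<in>S n. fst p \<le> e i \<and> e i \<le> snd p"
    and disj: "\<And>n p q. \<lbrakk>n \<in> N; p \<in> S n; q \<in> S n; p \<noteq> q\<rbrakk> \<Longrightarrow> snd p \<le> fst q \<or> snd q \<le> fst p"
  shows "\<exists>(f :: real \<Rightarrow> real) M. infinite M \<and> M \<subseteq> N \<and> continuous_on UNIV f \<and> (\<forall>y. f y \<in> {0..1}) \<and>
    (\<forall>n\<in>M. \<forall>y. (\<forall>p\<in>S n. y \<le> fst p) \<longrightarrow> f y = 0) \<and>
    (\<forall>n\<in>M. \<forall>y. (\<forall>p\<in>S n. snd p \<le> y) \<longrightarrow> f y = 1) \<and>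
    (\<forall>n\<in>M. \<forall>y z. y \<le> z \<longrightarrow> (\<forall>p\<in>S n. snd p \<le> y \<or> z \<le> fst p) \<longrightarrow> f y = f z)"
proof -
  \<comment> \<open>A state \<open>x\<close> is a level of the covers with \<open>2 ^ s\<close> of
    its intervals in increasing order. \<open>Q\<close> says that the next state has a higher level
    and puts two intervals inside each old one.\<close>
  define P where "P s x \<longleftrightarrow> fst x \<in> N \<and> (\<forall>j<2 ^ s. snd x j \<in> S (fst x)) \<and>
      (\<forall>j. Suc j < 2 ^ s \<longrightarrow> snd (snd x j) \<le> fst (snd x (Suc j)))"
    for s and x :: "nat \<times> (nat \<Rightarrow> real \<times> real)"
  define Q where "Q s x y \<longleftrightarrow> fst x < fst y \<and>
      (\<forall>j<2 ^ s. fst (snd x j) \<le> fst (snd y (2 * j)) \<and> snd (snd y (Suc (2 * j))) \<le> snd (snd x j))"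
    for s :: nat and x y :: "nat \<times> (nat \<Rightarrow> real \<times> real)"
  have "\<exists>F. \<forall>s. P s (F s) \<and> Q s (F s) (F (Suc s))"
  proof (rule dependent_nat_choice)
    \<comment> \<open>Positivity of \<open>n\<close> lets \<open>cover\<close> apply to index 0, so
      that \<open>S n\<close> has a member to serve as the root.\<close>
    obtain n where "n \<in> N" "n > 0" using N by (metis infinite_nat_iff_unbounded)
    then obtain p where "p \<in> S n" using cover by blast
    then show "\<exists>x. P 0 x" using \<open>n \<in> N\<close> by (intro exI[of _ "(n, \<lambda>_. p)"]) (simp add: P_def)
  next
    fix x s assume Px: "P s x"
    define n A where "n = fst x" and "A = snd x"
    have A: "n \<in> N" "\<And>j. j < 2 ^ s \<Longrightarrow> A j \<in> S n"
      "\<And>j. Suc j < 2 ^ s \<Longrightarrow> snd (A j) \<le> fst (A (Suc j))"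
      using Px by (auto simp: P_def n_def A_def)
    have "\<exists>m. \<forall>n\<ge>m. n \<in> N \<longrightarrow>
        (\<exists>p\<in>S n. \<exists>q\<in>S n. fst (A j) \<le> fst p \<and> snd p \<le> fst q \<and> snd q \<le> snd (A j))"
      if "j < 2 ^ s" for j
    proof -
      obtain k where "fst (A j) < e k" "e k < snd (A j)" using inner[OF A(1) A(2)[OF \<open>j < 2 ^ s\<close>]] by blast
      then show ?thesis
        by (rule two_subintervals[where e = e and N = N and S = S, rotated 4])
          (fact crowded short cover disj)+
    qed
    then obtain m where m: "\<And>j n. \<lbrakk>j < 2 ^ s; n \<ge> m j; n \<in> N\<rbrakk> \<Longrightarrow>
        \<exists>p\<in>S n. \<exists>q\<in>S n. fst (A j) \<le> fst p \<and> snd p \<le> fst q \<and> snd q \<le> snd (A j)"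
      by metis
    \<comment> \<open>Only finitely many intervals have to be split, so one level of the infinite
      set \<open>N\<close> lies beyond all their thresholds.\<close>
    obtain n' where n': "n' \<in> N" "n' > max n (Max (m ` {..<2 ^ s}))"
      using N by (metis infinite_nat_iff_unbounded)
    have "m j \<le> n'" if "j < 2 ^ s" for j
    proof -
      have "m j \<le> Max (m ` {..<2 ^ s})" using that by (intro Max_ge) auto
      then show ?thesis using n' by simp
    qed
    then have "\<exists>p q. p \<in> S n' \<and> q \<in> S n' \<and> fst (A j) \<le> fst p \<and> snd p \<le> fst q \<and> snd q \<le> snd (A j)"
      if "j < 2 ^ s" for j
      using m[OF that _ n'(1)] that by blast
    then obtain p q where pq: "\<And>j. j < 2 ^ s \<Longrightarrow> p j \<in> S n' \<and> q j \<in> S n' \<and>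
        fst (A j) \<le> fst (p j) \<and> snd (p j) \<le> fst (q j) \<and> snd (q j) \<le> snd (A j)"
      by metis
    \<comment> \<open>Left halves receive the even indices and right halves the odd ones, as
      \<open>interval_tree\<close> expects.\<close>
    define B where "B j = (if even j then p (j div 2) else q (j div 2))" for j
    have "B j \<in> S n'" if "j < 2 ^ Suc s" for j
      using that pq[of "j div 2"] by (auto simp: B_def)
    moreover have "snd (B j) \<le> fst (B (Suc j))" if j: "Suc j < 2 ^ Suc s" for j
    proof (cases "even j")
      case True
      then show ?thesis using j pq[of "j div 2"] by (auto simp: B_def elim!: evenE)
    next
      case False
      then obtain i where i: "j = Suc (2 * i)" by (metis oddE Suc_eq_plus1)
      then have "Suc i < 2 ^ s" using j by simp
      then show ?thesis
        using pq[of i] pq[of "Suc i"] A(3)[of i] i by (simp add: B_def)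
    qed
    ultimately have "P (Suc s) (n', B)" using n' by (simp add: P_def)
    moreover have "Q s x (n', B)"
      using n' pq by (auto simp: Q_def B_def n_def A_def)
    ultimately show "\<exists>y. P (Suc s) y \<and> Q s x y" by blast
  qed
  then obtain F where F: "\<And>s. P s (F s)" "\<And>s. Q s (F s) (F (Suc s))" by blast
  define \<nu> A where "\<nu> s = fst (F s)" and "A s = snd (F s)" for s
  have \<nu>: "\<nu> s \<in> N" for s using F(1)[of s] by (simp add: P_def \<nu>_def)
  have A: "A s j \<in> S (\<nu> s)" if "j < 2 ^ s" for s j
    using F(1)[of s] that by (simp add: P_def \<nu>_def A_def)
  interpret interval_tree "\<lambda>s j. fst (A s j)" "\<lambda>s j. snd (A s j)"
  proof
    show "fst (A s j) < snd (A s j)" if "j < 2 ^ s" for s j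
      using short[OF \<nu> A] that by blast
    show "snd (A s j) \<le> fst (A s (Suc j))" if "Suc j < 2 ^ s" for s j
      using F(1)[of s] that by (simp add: P_def A_def)
    show "fst (A s j) \<le> fst (A (Suc s) (2 * j))" if "j < 2 ^ s" for s j
      using F(2)[of s] that by (simp add: Q_def A_def)
    show "snd (A (Suc s) (Suc (2 * j))) \<le> snd (A s j)" if "j < 2 ^ s" for s j
      using F(2)[of s] that by (simp add: Q_def A_def)
  qed
  have "strict_mono \<nu>"
    using F(2) by (intro strict_monoI_Suc) (simp add: Q_def \<nu>_def)
  then have "infinite (range \<nu>)" by (simp add: range_inj_infinite strict_mono_imp_inj_on)
  show ?thesis
  proof (intro exI[of _ cf] exI[of _ "range \<nu>"] conjI ballI allI impI)
    show "infinite (range \<nu>)" by fact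
    show "range \<nu> \<subseteq> N" using \<nu> by blast
    show "continuous_on UNIV cf" by (rule continuous_cf)
    show "cf y \<in> {0..1}" for y using cf_bounds by simp
    show "cf y = 0" if "n \<in> range \<nu>" "\<forall>p\<in>S n. y \<le> fst p" for n y
    proof -
      obtain s where "n = \<nu> s" using \<open>n \<in> range \<nu>\<close> by blast
      then show ?thesis using that A by (intro cf_eq_0[of s]) blast
    qed
    show "cf y = 1" if "n \<in> range \<nu>" "\<forall>p\<in>S n. snd p \<le> y" for n y
    proof -
      obtain s where "n = \<nu> s" using \<open>n \<in> range \<nu>\<close> by blast
      then show ?thesis using that A by (intro cf_eq_1[of s]) blast
    qed
    show "cf y = cf z" if "n \<in> range \<nu>" "y \<le> z" "\<forall>p\<in>S n. snd p \<le> y \<or> z \<le> fst p" for n y z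
    proof -
      obtain s where "n = \<nu> s" using \<open>n \<in> range \<nu>\<close> by blast
      then show ?thesis using that A by (intro cf_eq[of _ _ s]) blast+
    qed
  qed
qed

text \<open>\<open>\<phi> m y\<close> is the Lebesgue measure of what remains of
  \<open>[0, y]\<close> after removing all intervals of level at least \<open>m\<close>. This is
  1-Lipschitz, does not grow along a removed interval, and loses at most the total removed length, a
  geometric tail.\<close>

lemma collapse_intervals:
  fixes S :: "nat \<Rightarrow> (real \<times> real) set"
  assumes fin: "\<And>n. finite (S n)"
    and pos: "\<And>n p. p \<in> S n \<Longrightarrow> 0 \<le> fst p \<and> fst p \<le> snd p"
    and total: "\<And>n. (\<Sum>p\<in>S n. snd p - fst p) \<le> (1 / 2) ^ n"
  obtains \<phi> :: "nat \<Rightarrow> real \<Rightarrow> real"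
  where "\<And>m. continuous_on UNIV (\<phi> m)" "\<And>m y. y \<in> {0..1} \<Longrightarrow> \<phi> m y \<in> {0..1}"
    "\<And>m y. 0 \<le> y \<Longrightarrow> \<bar>\<phi> m y - y\<bar> \<le> 2 * (1 / 2) ^ m"
    "\<And>m n p. \<lbrakk>m \<le> n; p \<in> S n\<rbrakk> \<Longrightarrow> \<phi> m (fst p) = \<phi> m (snd p)"
proof -
  define I where "I n = (\<Union>p\<in>S n. {fst p..snd p})" for n
  define A where "A m = (\<Union>k. I (m + k))" for m
  define \<phi> where "\<phi> m y = measure lborel ({0..y} - A m)" for m y
  have I_sets: "I n \<in> sets lborel" for n
    unfolding I_def using fin by (intro sets.finite_UN) auto
  have A_sets [simp]: "A m \<in> sets borel" for m
    unfolding A_def using I_sets by auto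
  have I_meas: "emeasure lborel (I n) \<le> ennreal ((1 / 2) ^ n)" for n
  proof -
    have "emeasure lborel (I n) \<le> (\<Sum>p\<in>S n. emeasure lborel {fst p..snd p})"
      unfolding I_def using fin by (intro emeasure_subadditive_finite) auto
    also have "\<dots> = (\<Sum>p\<in>S n. ennreal (snd p - fst p))"
      using pos by (intro sum.cong) auto
    also have "\<dots> = ennreal (\<Sum>p\<in>S n. snd p - fst p)"
      using pos by (intro sum_ennreal) auto
    also have "\<dots> \<le> ennreal ((1 / 2) ^ n)" using total by (intro ennreal_leI)
    finally show ?thesis .
  qed
  have A_meas: "emeasure lborel (A m) \<le> ennreal (2 * (1 / 2) ^ m)" for m
  proof -
    have "emeasure lborel (A m) \<le> (\<Sum>k. emeasure lborel (I (m + k)))"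
      unfolding A_def using I_sets by (intro emeasure_subadditive_countably) auto
    also have "\<dots> \<le> (\<Sum>k. ennreal ((1 / 2) ^ (m + k)))"
      by (intro suminf_le I_meas) auto
    also have "\<dots> = ennreal (2 * (1 / 2) ^ m)"
    proof (rule suminf_ennreal_eq)
      show "(\<lambda>k. (1 / 2) ^ (m + k)) sums (2 * (1 / 2 :: real) ^ m)"
        using sums_mult[OF geometric_sums[of "1 / 2 :: real"], of "(1 / 2) ^ m"]
        by (simp add: power_add mult.commute)
    qed simp
    finally show ?thesis .
  qed
  have fm: "{0..y} - A m \<in> fmeasurable lborel" for y m
    by (intro fmeasurable_Diff) (auto simp: fmeasurable_def emeasure_lborel_Icc_eq)
  have Afm: "A m \<in> fmeasurable lborel" for m
    using A_meas[of m] by (auto simp: fmeasurable_def top_unique intro: le_less_trans)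
  have mono: "\<phi> m y \<le> \<phi> m z" if "y \<le> z" for m y z
    unfolding \<phi>_def using that fm by (intro measure_mono_fmeasurable) (auto dest: fmeasurableD)
  have lip: "\<phi> m z \<le> \<phi> m y + (z - y)" if "y \<le> z" for m y z
  proof -
    have "\<phi> m z \<le> measure lborel (({0..y} - A m) \<union> {y..z})"
      unfolding \<phi>_def using fm
      by (intro measure_mono_fmeasurable fmeasurable.Un) (auto dest: fmeasurableD simp: fmeasurable_def emeasure_lborel_Icc_eq)
    also have "\<dots> \<le> \<phi> m y + measure lborel {y..z}"
      unfolding \<phi>_def by (intro measure_Un_le) auto
    finally show ?thesis using that by simp
  qed
  show ?thesis
  proof (rule that[of \<phi>])
    show "continuous_on UNIV (\<phi> m)" for m
      unfolding continuous_on_iff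
    proof (intro ballI allI impI)
      fix x \<epsilon> :: real assume "\<epsilon> > 0"
      have "dist (\<phi> m y) (\<phi> m x) \<le> dist y x" for y
        using mono[of y x m] mono[of x y m] lip[of y x m] lip[of x y m]
        by (cases "x \<le> y") (auto simp: dist_real_def)
      then show "\<exists>d>0. \<forall>x'\<in>UNIV. dist x' x < d \<longrightarrow> dist (\<phi> m x') (\<phi> m x) < \<epsilon>"
        using \<open>\<epsilon> > 0\<close> by (meson le_less_trans)
    qed
    have ub: "\<phi> m y \<le> y" if "0 \<le> y" for m y
    proof -
      have "\<phi> m y \<le> measure lborel {0..y}"
        unfolding \<phi>_def by (intro measure_mono_fmeasurable) (auto simp: fmeasurable_def emeasure_lborel_Icc_eq)
      then show ?thesis using that by simp
    qed
    show "\<phi> m y \<in> {0..1}" if "y \<in> {0..1}" for m y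
      using ub[of y m] that by (auto simp: \<phi>_def)
    show "\<bar>\<phi> m y - y\<bar> \<le> 2 * (1 / 2) ^ m" if "0 \<le> y" for m y
    proof -
      have "measure lborel {0..y} \<le> measure lborel (({0..y} - A m) \<union> A m)"
        using fm Afm by (intro measure_mono_fmeasurable fmeasurable.Un) auto
      also have "\<dots> \<le> \<phi> m y + measure lborel (A m)"
        unfolding \<phi>_def by (intro measure_Un_le) auto
      also have "measure lborel (A m) \<le> 2 * (1 / 2) ^ m"
        unfolding measure_def using A_meas[of m] by (intro enn2real_leI) auto
      finally show ?thesis using ub[OF that, of m] that by simp
    qed
    show "\<phi> m (fst p) = \<phi> m (snd p)" if "m \<le> n" "p \<in> S n" for m n p
    proof -
      have "{fst p..snd p} \<subseteq> A m"
        unfolding A_def I_def using that by (auto intro!: bexI[of _ p] exI[of _ "n - m"])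
      then have "y \<le> fst p" if "y \<in> {0..snd p}" "y \<notin> A m" for y
        using that by (meson atLeastAtMost_iff linear subsetD)
      then have "{0..fst p} - A m = {0..snd p} - A m"
        using pos[OF \<open>p \<in> S n\<close>] by auto
      then show ?thesis by (simp add: \<phi>_def)
    qed
  qed
qed

section \<open>Crowded sequences and closed discrete sequences in metric spaces\<close>

text \<open>Each \<open>c p\<close> is the coefficient sequence of a nonzero power series on the
  unit disc, which has finitely many zeros in the closed disc of radius 1/2. Countably many series
  have countably many such zeros, and the interval \<open>(0, 1/2)\<close> is uncountable.\<close>

lemma separating_parameter:
  fixes c :: "'p \<Rightarrow> nat \<Rightarrow> real"
  assumes "countable P" and bounded: "\<And>p i. p \<in> P \<Longrightarrow> \<bar>c p i\<bar> \<le> 1"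
    and nz: "\<And>p. p \<in> P \<Longrightarrow> \<exists>i. c p i \<noteq> 0"
  obtains t :: real where "0 < t" "t < 1 / 2" "\<And>p. p \<in> P \<Longrightarrow> (\<Sum>i. c p i * t ^ i) \<noteq> 0"
proof -
  define h where "h p z = (\<Sum>i. of_real (c p i) * z ^ i)" for p and z :: complex
  have summable: "summable (\<lambda>i. of_real (c p i) * z ^ i)" if "p \<in> P" "norm z < 1" for p and z :: complex
  proof (rule summable_comparison_test)
    show "\<exists>N. \<forall>n\<ge>N. norm (of_real (c p n) * z ^ n) \<le> norm z ^ n"
      using bounded[OF \<open>p \<in> P\<close>]
      by (intro exI[of _ 0]) (auto simp: norm_mult norm_power intro: mult_left_le_one_le)
    show "summable (\<lambda>n. norm z ^ n)" using that by (simp add: summable_geometric)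
  qed
  then have sums: "(\<lambda>i. of_real (c p i) * (z - 0) ^ i) sums h p z"
    if "p \<in> P" "z \<in> ball 0 1" for p and z :: complex
    using that by (auto simp: h_def summable_sums)
  have finite_zeros: "finite {z \<in> cball 0 (1 / 2). h p z = 0}" if p: "p \<in> P" for p
  \<comment> \<open>The finiteness theorem for zeros concerns nonconstant functions. A constant
    series can vanish only identically, which a nonzero coefficient rules out.\<close>
  proof (cases "h p constant_on ball 0 1")
    case True
    then obtain k where k: "\<And>z. z \<in> ball 0 1 \<Longrightarrow> h p z = k" by (auto simp: constant_on_def)
    show ?thesis
    proof (cases "k = 0")
      case True
      obtain m where m: "c p m \<noteq> 0" using nz p by blast
      have "h p 0 = of_real (c p 0)" by (simp add: h_def)
      then have "m > 0" using m k[of 0] True by (cases m) auto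
      obtain s where s: "s > 0" "\<And>z. z \<in> cball 0 s - {0} \<Longrightarrow> h p z \<noteq> 0"
        by (rule powser_0_nonzero[of 1 0 "\<lambda>i. of_real (c p i)" "h p" m])
          (use sums[OF p] k[of 0] True m \<open>m > 0\<close> in auto)
      have "h p (of_real (min s (1 / 2))) \<noteq> 0" using s by (intro s) auto
      moreover have "h p (of_real (min s (1 / 2))) = 0" using s(1) k True by (intro k[unfolded True]) auto
      ultimately show ?thesis by contradiction
    next
      case False
      then have "{z \<in> cball 0 (1 / 2). h p z = 0} = {}" using k by auto
      then show ?thesis by (metis finite.emptyI)
    qed
  next
    case False
    have "h p holomorphic_on ball 0 1" by (rule power_series_holomorphic) (use sums p in auto)
    then show ?thesis
      using False by (intro holomorphic_compact_finite_zeros[of _ "ball 0 1"]) auto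
  qed
  define Z where "Z = (\<Union>p\<in>P. {z \<in> cball 0 (1 / 2). h p z = 0})"
  have "countable Z" unfolding Z_def using \<open>countable P\<close> finite_zeros by (blast intro: countable_finite)
  \<comment> \<open>The zeros are complex while the parameter is to be real; a real zero is its own
    real part.\<close>
  then have "countable (Re ` Z)" by blast
  then have "\<not> {0 <..< 1 / 2 :: real} \<subseteq> Re ` Z"
    using uncountable_open_interval[of 0 "1 / 2 :: real"] countable_subset by auto
  then obtain t where "t \<in> {0 <..< 1 / 2}" and tZ: "t \<notin> Re ` Z" by blast
  then have t: "0 < t" "t < 1 / 2" by auto
  have "(\<Sum>i. c p i * t ^ i) \<noteq> 0" if p: "p \<in> P" for p
  proof
    assume 0: "(\<Sum>i. c p i * t ^ i) = 0"
    have "summable (\<lambda>i. complex_of_real (c p i * t ^ i))"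
      using summable[OF p, of "of_real t"] t by simp
    then have "summable (\<lambda>i. c p i * t ^ i)" by (simp only: summable_complex_of_real)
    then have "h p (of_real t) = of_real (\<Sum>i. c p i * t ^ i)"
      using suminf_of_real[of "\<lambda>i. c p i * t ^ i", where 'a = complex] by (simp add: h_def)
    then have "complex_of_real t \<in> Z" unfolding Z_def using p t 0 by (auto intro!: bexI[of _ p])
    then have "Re (complex_of_real t) \<in> Re ` Z" by (rule imageI)
    then show False using tZ by simp
  qed
  then show ?thesis using that t by blast
qed

context Metric_space
begin

lemma lipschitz_continuous_map:
  assumes "\<And>x y. x \<in> M \<Longrightarrow> y \<in> M \<Longrightarrow> f x \<le> f y + C * d x y" and "C > 0"
  shows "continuous_map mtopology euclideanreal f"
proof -
  have *: "\<bar>f x - f y\<bar> \<le> C * d x y" if "x \<in> M" "y \<in> M" for x y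
    using assms(1)[OF that] assms(1)[OF that(2,1)] by (simp add: commute)
  have "\<exists>\<delta>>0. \<forall>x. x \<in> M \<and> d a x < \<delta> \<longrightarrow> dist (f a) (f x) < \<epsilon>" if "a \<in> M" "\<epsilon> > 0" for a \<epsilon>
  proof (intro exI[of _ "\<epsilon> / C"] conjI allI impI)
    show "\<epsilon> / C > 0" using that \<open>C > 0\<close> by simp
    fix x assume x: "x \<in> M \<and> d a x < \<epsilon> / C"
    then have "C * d a x < \<epsilon>" using \<open>C > 0\<close> by (simp add: field_simps)
    then show "dist (f a) (f x) < \<epsilon>" using *[of a x] that x by (simp add: dist_real_def)
  qed
  then have "continuous_map mtopology (Met_TC.mtopology) f"
    by (subst metric_continuous_map) (auto simp: Met_TC.Metric_space_axioms)
  then show ?thesis by simp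
qed

text \<open>\<open>nx n\<close> moves a point of \<open>S\<close> to a different one within
  \<open>1 / (n + 1)\<close>. The points reached from \<open>x0\<close> by finite lists of such
  moves are countably many, and prepending one more move stays close to the given point.\<close>

lemma countable_crowded_sequence:
  assumes "S \<subseteq> M" "x0 \<in> S"
    and crowded: "\<And>x \<epsilon>. x \<in> S \<Longrightarrow> \<epsilon> > 0 \<Longrightarrow> \<exists>y\<in>S. y \<noteq> x \<and> d y x < \<epsilon>"
  obtains q :: "nat \<Rightarrow> 'a" where "range q \<subseteq> S"
    "\<And>i \<epsilon>. \<epsilon> > 0 \<Longrightarrow> \<exists>k. q k \<noteq> q i \<and> d (q k) (q i) < \<epsilon>"
proof -
  define nx where "nx n x = (SOME y. y \<in> S \<and> y \<noteq> x \<and> d y x < inverse (real (Suc n)))" for n x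
  have nx: "nx n x \<in> S \<and> nx n x \<noteq> x \<and> d (nx n x) x < inverse (real (Suc n))" if "x \<in> S" for n x
    unfolding nx_def
    by (rule someI_ex) (use crowded[OF that, of "inverse (real (Suc n))"] in auto)
  define w where "w ns = foldr nx ns x0" for ns
  have w: "w ns \<in> S" for ns
    by (induction ns) (use nx \<open>x0 \<in> S\<close> in \<open>auto simp: w_def\<close>)
  show ?thesis
  proof (rule that[of "\<lambda>i. w (from_nat i)"])
    show "range (\<lambda>i. w (from_nat i)) \<subseteq> S" using w by blast
    show "\<exists>k. w (from_nat k) \<noteq> w (from_nat i) \<and> d (w (from_nat k)) (w (from_nat i)) < \<epsilon>"
      if "\<epsilon> > 0" for i \<epsilon>
    proof -
      obtain n where n: "inverse (real (Suc n)) < \<epsilon>" using reals_Archimedean[OF \<open>\<epsilon> > 0\<close>] by blast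
      let ?ns = "from_nat i :: nat list"
      have "w (n # ?ns) \<noteq> w ?ns \<and> d (w (n # ?ns)) (w ?ns) < \<epsilon>"
        using nx[OF w[of ?ns], of n] n by (auto simp: w_def)
      then show ?thesis by (intro exI[of _ "to_nat (n # ?ns)"]) simp
    qed
  qed
qed

text \<open>Small closed balls around \<open>a\<close> are not compact, hence contain infinite sets
  without accumulation points. The bound \<open>\<delta>\<close> says that no subsequence of
  \<open>\<sigma>\<close> converges to \<open>x\<close>; the summand \<open>(1 / 2) ^ n\<close>
  keeps it positive when \<open>x\<close> is itself a term.\<close>

lemma not_locally_compact_point:
  assumes "\<not> locally_compact_space mtopology"
  obtains a where "a \<in> M"
    "\<And>r. r > 0 \<Longrightarrow> \<exists>\<sigma>::nat \<Rightarrow> 'a. range \<sigma> \<subseteq> mball a r - {a} \<and>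
      (\<forall>x\<in>M. \<exists>\<delta>>0. \<forall>n. \<delta> \<le> d x (\<sigma> n) + (1 / 2) ^ n)"
proof -
  obtain a where a: "a \<in> M"
    and nc: "\<And>U K. \<lbrakk>openin mtopology U; compactin mtopology K; a \<in> U\<rbrakk> \<Longrightarrow> \<not> U \<subseteq> K"
    using assms by (auto simp: locally_compact_space_def)
  have "\<exists>\<sigma>::nat \<Rightarrow> 'a. range \<sigma> \<subseteq> mball a r - {a} \<and>
      (\<forall>x\<in>M. \<exists>\<delta>>0. \<forall>n. \<delta> \<le> d x (\<sigma> n) + (1 / 2) ^ n)" if "r > 0" for r
  proof -
    let ?S = "mcball a (r / 2)"
    have "\<not> compactin mtopology ?S"
      using nc[of "mball a (r / 2)" ?S] a \<open>r > 0\<close> by auto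
    then obtain T where T: "T \<subseteq> ?S" "infinite T" "?S \<inter> mtopology derived_set_of T = {}"
      unfolding compactin_eq_Bolzano_Weierstrass using mcball_subset_mspace by blast
    \<comment> \<open>Accumulation points of \<open>T\<close> would lie in the closed ball, so
      excluding them there excludes them everywhere.\<close>
    have "mtopology derived_set_of T \<subseteq> mtopology closure_of ?S"
      using T(1) by (meson closure_of_mono derived_set_of_subset_closure_of subset_trans)
    also have "\<dots> = ?S" by (simp add: closure_of_closedin)
    finally have dT: "mtopology derived_set_of T = {}" using T(3) by blast
    obtain \<sigma> :: "nat \<Rightarrow> 'a" where \<sigma>: "inj \<sigma>" "range \<sigma> \<subseteq> T - {a}"
      using infinite_countable_subset[of "T - {a}"] T(2) by auto
    have "range \<sigma> \<subseteq> mball a r - {a}"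
    proof -
      have "T \<subseteq> mball a r" using T(1) \<open>r > 0\<close> by (auto simp: subset_iff)
      then show ?thesis using \<sigma> by blast
    qed
    moreover have "\<exists>\<delta>>0. \<forall>n. \<delta> \<le> d x (\<sigma> n) + (1 / 2) ^ n" if "x \<in> M" for x
    proof -
      have "x \<notin> mtopology derived_set_of T" using dT by simp
      then obtain \<rho> where \<rho>: "\<rho> > 0" "\<And>y. y \<in> T \<Longrightarrow> y \<noteq> x \<Longrightarrow> y \<notin> mball x \<rho>"
        using \<open>x \<in> M\<close> by (auto simp: metric_derived_set_of)
      have far: "\<rho> \<le> d x (\<sigma> n)" if "\<sigma> n \<noteq> x" for n
      proof -
        have "\<sigma> n \<in> T" using \<sigma> by blast
        moreover have "T \<subseteq> M" using T(1) mcball_subset_mspace by blast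
        ultimately show ?thesis using \<rho>(2)[of "\<sigma> n"] that \<open>x \<in> M\<close> by auto
      qed
      show ?thesis
      proof (cases "x \<in> range \<sigma>")
        case True
        then obtain m where m: "x = \<sigma> m" by blast
        have "min \<rho> ((1 / 2) ^ m) \<le> d x (\<sigma> n) + (1 / 2) ^ n" for n
        proof (cases "n = m")
          case True
          then show ?thesis using nonneg[of x "\<sigma> n"] by (simp add: min.coboundedI2)
        next
          case False
          then have "\<sigma> n \<noteq> x" using m \<sigma>(1) by (auto dest: injD)
          then have "\<rho> \<le> d x (\<sigma> n) + (1 / 2) ^ n" using far by (smt (verit) zero_le_divide_1_iff zero_le_power)
          then show ?thesis by linarith
        qed
        then show ?thesis using \<rho>(1) by (intro exI[of _ "min \<rho> ((1 / 2) ^ m)"]) auto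
      next
        case False
        then have "\<rho> \<le> d x (\<sigma> n) + (1 / 2) ^ n" for n
          using far[of n] by (smt (verit) rangeI zero_le_divide_1_iff zero_le_power)
        then show ?thesis using \<rho>(1) by blast
      qed
    qed
    ultimately show ?thesis by blast
  qed
  then show ?thesis using that a by blast
qed

text \<open>Take the infimum over \<open>n\<close> of \<open>d x (\<sigma> n) + (1 / 2) ^ n\<close>,
  truncated at \<open>r\<close>. It is Lipschitz as an infimum of Lipschitz functions and positive
  by discreteness, yet tends to 0 along \<open>\<sigma>\<close>: \<open>f\<close> approaches 0
  without attaining it.\<close>

lemma escape_function:
  fixes \<sigma> :: "nat \<Rightarrow> 'a"
  assumes "range \<sigma> \<subseteq> M" "r > 0"
    and discrete: "\<And>x. x \<in> M \<Longrightarrow> \<exists>\<delta>>0. \<forall>n. \<delta> \<le> d x (\<sigma> n) + (1 / 2) ^ n"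
  obtains f :: "'a \<Rightarrow> real" where "continuous_map mtopology euclideanreal f"
    "\<And>x. x \<in> M \<Longrightarrow> 0 < f x \<and> f x \<le> r" "\<And>n. f (\<sigma> n) \<le> (1 / 2) ^ n"
    "\<And>x. \<lbrakk>x \<in> M; \<And>n. r \<le> d x (\<sigma> n)\<rbrakk> \<Longrightarrow> f x = r"
proof -
  define g where "g x = (INF n. d x (\<sigma> n) + (1 / 2) ^ n)" for x
  have bdd: "bdd_below (range (\<lambda>n. d x (\<sigma> n) + (1 / 2) ^ n))" for x
    by (rule bdd_belowI2[where m = 0]) simp
  have g_le: "g x \<le> d x (\<sigma> n) + (1 / 2) ^ n" for x n
    unfolding g_def by (rule cINF_lower[OF bdd]) simp
  have le_g: "c \<le> g x" if "\<And>n. c \<le> d x (\<sigma> n) + (1 / 2) ^ n" for c x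
    unfolding g_def using that by (intro cINF_greatest) auto
  show ?thesis
  proof (rule that[of "\<lambda>x. min r (g x)"])
    show "continuous_map mtopology euclideanreal (\<lambda>x. min r (g x))"
    proof (rule lipschitz_continuous_map[where C = 1])
      fix x y assume xy: "x \<in> M" "y \<in> M"
      have "g x - d x y \<le> g y"
      proof (rule le_g)
        fix n
        have "\<sigma> n \<in> M" using assms(1) by blast
        then show "g x - d x y \<le> d y (\<sigma> n) + (1 / 2) ^ n"
          using g_le[of x n] triangle[OF xy, of "\<sigma> n"] by linarith
      qed
      then show "min r (g x) \<le> min r (g y) + 1 * d x y" using nonneg[of x y] by linarith
    qed simp
    show "0 < min r (g x) \<and> min r (g x) \<le> r" if "x \<in> M" for x
    proof -
      obtain \<delta> where "\<delta> > 0" "\<And>n. \<delta> \<le> d x (\<sigma> n) + (1 / 2) ^ n" using discrete[OF \<open>x \<in> M\<close>] by blast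
      then have "\<delta> \<le> g x" by (intro le_g)
      then show ?thesis using \<open>\<delta> > 0\<close> \<open>r > 0\<close> by simp
    qed
    show "min r (g (\<sigma> n)) \<le> (1 / 2) ^ n" for n
    proof -
      have "\<sigma> n \<in> M" using assms(1) by blast
      then show ?thesis using g_le[of "\<sigma> n" n] by simp
    qed
    show "min r (g x) = r" if "x \<in> M" "\<And>n. r \<le> d x (\<sigma> n)" for x
    proof -
      have "r \<le> d x (\<sigma> n) + (1 / 2) ^ n" for n using that(2)[of n] by (simp add: add_increasing2)
      then have "r \<le> g x" by (rule le_g)
      then show ?thesis by simp
    qed
  qed
qed

text \<open>\<open>g\<close> sums the distances to the points \<open>q i\<close>, truncated at
  \<open>r\<close>, with weights \<open>t ^ i\<close>. Truncation makes it constant away from the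
  sequence, and a generic \<open>t\<close> makes it injective on the sequence.\<close>

lemma separating_function:
  fixes q :: "nat \<Rightarrow> 'a"
  assumes "range q \<subseteq> M" "0 < r" "r \<le> 1 / 2"
  obtains g :: "'a \<Rightarrow> real" where "continuous_map mtopology euclideanreal g"
    "\<And>x. g x \<in> {0..1}" "inj_on g (range q)"
    "\<And>x y. \<lbrakk>\<And>i. r \<le> d x (q i); \<And>i. r \<le> d y (q i)\<rbrakk> \<Longrightarrow> g x = g y"
proof -
  define c where "c x i = min r (d x (q i))" for x i
  have c: "0 \<le> c x i" "c x i \<le> 1 / 2" for x i using assms by (auto simp: c_def)
  define P where "P = {(x, y). x \<in> range q \<and> y \<in> range q \<and> x \<noteq> y}"
  have cP: "countable P" by (rule countable_subset[of _ "range q \<times> range q"]) (auto simp: P_def)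
  have bP: "\<bar>c (fst p) i - c (snd p) i\<bar> \<le> 1" for p i
    using c[of "fst p" i] c[of "snd p" i] by linarith
  have nP: "\<exists>i. c (fst p) i - c (snd p) i \<noteq> 0" if "p \<in> P" for p
  proof -
    obtain i y where p: "p = (q i, y)" "y \<in> range q" "q i \<noteq> y" using \<open>p \<in> P\<close> unfolding P_def by blast
    have "q i \<in> M" "y \<in> M" using p(2) assms(1) by auto
    then have "d y (q i) > 0" "d (q i) (q i) = 0" using p(3) by auto
    \<comment> \<open>The truncated distance to \<open>q i\<close> vanishes at \<open>q i\<close>
      itself but not at \<open>y\<close>.\<close>
    then show ?thesis using p assms by (intro exI[of _ i]) (auto simp: c_def)
  qed
  obtain t where t: "0 < t" "t < 1 / 2"
    "\<And>p. p \<in> P \<Longrightarrow> (\<Sum>i. (c (fst p) i - c (snd p) i) * t ^ i) \<noteq> 0"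
    using separating_parameter[where c = "\<lambda>p i. c (fst p) i - c (snd p) i", OF cP bP nP] by blast
  define g where "g x = (\<Sum>i. c x i * t ^ i)" for x
  have geo: "(\<lambda>i. t ^ i) sums (1 / (1 - t))" using t by (intro geometric_sums) auto
  have summable: "summable (\<lambda>i. c x i * t ^ i)" for x
  proof (rule summable_comparison_test)
    show "\<exists>N. \<forall>n\<ge>N. norm (c x n * t ^ n) \<le> t ^ n"
      using c t by (intro exI[of _ 0]) (auto simp: abs_mult intro!: mult_left_le_one_le order_trans[OF c(2)])
    show "summable (\<lambda>n. t ^ n)" using geo by (rule sums_summable)
  qed
  \<comment> \<open>This gives the Lipschitz constant 2 and, with terms bounded by
    \<open>1 / 2 * t ^ i\<close>, the upper bound 1 for \<open>g\<close>.\<close>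
  have inv: "1 / (1 - t) \<le> 2" using t by (simp add: field_simps)
  show ?thesis
  proof (rule that[of g])
    show "continuous_map mtopology euclideanreal g"
    proof (rule lipschitz_continuous_map[where C = 2])
      fix x y assume xy: "x \<in> M" "y \<in> M"
      have sm: "summable (\<lambda>i. c y i * t ^ i + d x y * t ^ i)"
        using summable geo by (intro summable_add summable_mult) (auto dest: sums_summable)
      have "g x \<le> (\<Sum>i. c y i * t ^ i + d x y * t ^ i)"
        unfolding g_def
      proof (rule suminf_le[OF _ summable sm])
        fix i
        have "q i \<in> M" using assms(1) by blast
        then have "c x i \<le> c y i + d x y"
          unfolding c_def using triangle[of x y "q i"] xy nonneg[of x y] by linarith
        then have "c x i * t ^ i \<le> (c y i + d x y) * t ^ i" using t by (intro mult_right_mono) auto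
        then show "c x i * t ^ i \<le> c y i * t ^ i + d x y * t ^ i" by (simp add: algebra_simps)
      qed
      also have "\<dots> = g y + d x y * (1 / (1 - t))"
        unfolding g_def using geo summable
        by (subst suminf_add[symmetric]) (auto simp: sums_iff suminf_mult summable_mult)
      also have "\<dots> \<le> g y + 2 * d x y"
        using mult_left_mono[OF inv nonneg[of x y]] by simp
      finally show "g x \<le> g y + 2 * d x y" .
    qed simp
    show "g x \<in> {0..1}" for x
    proof -
      have "0 \<le> g x" unfolding g_def using c t summable by (intro suminf_nonneg) auto
      moreover have "g x \<le> (\<Sum>i. 1 / 2 * t ^ i)"
        unfolding g_def using c t summable geo
        by (intro suminf_le mult_right_mono summable_mult) (auto dest: sums_summable)
      moreover have "(\<Sum>i. 1 / 2 * t ^ i) = 1 / 2 * (1 / (1 - t))"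
        using geo by (subst suminf_mult) (auto simp: sums_iff)
      ultimately have "0 \<le> g x" "g x \<le> 1" using inv by linarith+
      then show ?thesis by simp
    qed
    show "inj_on g (range q)"
    proof (rule inj_onI, rule ccontr)
      fix x y assume xy: "x \<in> range q" "y \<in> range q" "g x = g y" "x \<noteq> y"
      then have "(x, y) \<in> P" by (auto simp: P_def)
      moreover have "(\<Sum>i. (c x i - c y i) * t ^ i) = g x - g y"
        unfolding g_def by (subst suminf_diff[OF summable summable]) (simp add: algebra_simps)
      ultimately show False using t(3)[of "(x, y)"] xy by simp
    qed
    show "g x = g y" if "\<And>i. r \<le> d x (q i)" "\<And>i. r \<le> d y (q i)" for x y
      using that by (simp add: g_def c_def min_absorb1)
  qed
qed

end

section \<open>Alternating products in topological groups\<close>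

lemma hom_eq_on_generate:
  assumes "group G" "group H" "f \<in> hom G H" "h \<in> hom G H"
    and S: "S \<subseteq> carrier G" "\<And>x. x \<in> S \<Longrightarrow> f x = h x" and "x \<in> generate G S"
  shows "f x = h x"
proof -
  interpret f: group_hom G H f using assms by (simp add: group_hom_def group_hom_axioms_def)
  interpret h: group_hom G H h using assms by (simp add: group_hom_def group_hom_axioms_def)
  have "x \<in> carrier G \<and> f x = h x" using \<open>x \<in> generate G S\<close>
    by induction (use S in \<open>auto simp: subset_iff\<close>)
  then show ?thesis by simp
qed

definition alt_prod :: "('g, 'm) monoid_scheme \<Rightarrow> ('g \<times> 'g) list \<Rightarrow> 'g" where
  "alt_prod G ps = foldr (\<lambda>p u. (inv\<^bsub>G\<^esub> fst p \<otimes>\<^bsub>G\<^esub> snd p) \<otimes>\<^bsub>G\<^esub> u) ps \<one>\<^bsub>G\<^esub>"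

lemma alt_prod_Nil [simp]: "alt_prod G [] = \<one>\<^bsub>G\<^esub>"
  and alt_prod_Cons [simp]:
    "alt_prod G (p # ps) = (inv\<^bsub>G\<^esub> fst p \<otimes>\<^bsub>G\<^esub> snd p) \<otimes>\<^bsub>G\<^esub> alt_prod G ps"
  by (simp_all add: alt_prod_def)

lemma (in group) alt_prod_closed [intro, simp]:
  "set ps \<subseteq> carrier G \<times> carrier G \<Longrightarrow> alt_prod G ps \<in> carrier G"
  by (induction ps) auto

lemma (in group) alt_prod_eq_one:
  "set ps \<subseteq> carrier G \<times> carrier G \<Longrightarrow> (\<And>p. p \<in> set ps \<Longrightarrow> fst p = snd p) \<Longrightarrow> alt_prod G ps = \<one>"
  by (induction ps) (auto simp: subset_iff)

lemma (in group_hom) hom_alt_prod: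
  "set ps \<subseteq> carrier G \<times> carrier G \<Longrightarrow> h (alt_prod G ps) = alt_prod H (map (map_prod h h) ps)"
  by (induction ps) auto

text \<open>Between consecutive intervals \<open>F\<close> is constant, so the last factor of each
  pair cancels the inverse that opens the next. The induction moves \<open>s\<close> to the right
  end of the first interval.\<close>

lemma (in group) alt_prod_telescope:
  fixes F :: "real \<Rightarrow> 'a"
  assumes F: "\<And>y. F y \<in> carrier G"
    and "sorted_wrt (\<lambda>p p'. snd p < fst p') ps" "s \<le> t"
    and "\<And>p. p \<in> set ps \<Longrightarrow> s \<le> fst p \<and> fst p \<le> snd p \<and> snd p \<le> t"
    and "\<And>y z. \<lbrakk>s \<le> y; y \<le> z; z \<le> t; \<And>p. p \<in> set ps \<Longrightarrow> snd p \<le> y \<or> z \<le> fst p\<rbrakk> \<Longrightarrow> F y = F z"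
  shows "alt_prod G (map (map_prod F F) ps) = inv F s \<otimes> F t"
  using assms(2-)
proof (induction ps arbitrary: s)
  case Nil
  have "F s = F t" using Nil.prems(2) by (intro Nil.prems(4)) auto
  then show ?case using F by simp
next
  case (Cons p ps)
  have p: "s \<le> fst p" "fst p \<le> snd p" "snd p \<le> t" using Cons.prems(3)[of p] by auto
  have later: "snd p < fst p'" if "p' \<in> set ps" for p' using Cons.prems(1) that by auto
  have "F s = F (fst p)"
  proof (rule Cons.prems(4))
    show "snd p' \<le> s \<or> fst p \<le> fst p'" if "p' \<in> set (p # ps)" for p'
      using that later[of p'] p by auto
  qed (use p in auto)
  moreover have "alt_prod G (map (map_prod F F) ps) = inv F (snd p) \<otimes> F t"
  proof (rule Cons.IH)
    show "sorted_wrt (\<lambda>p p'. snd p < fst p') ps" using Cons.prems(1) by simp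
    show "snd p \<le> fst p' \<and> fst p' \<le> snd p' \<and> snd p' \<le> t" if "p' \<in> set ps" for p'
      using later[OF that] Cons.prems(3)[of p'] that by auto
    show "F y = F z" if "snd p \<le> y" "y \<le> z" "z \<le> t" "\<And>p'. p' \<in> set ps \<Longrightarrow> snd p' \<le> y \<or> z \<le> fst p'" for y z
      using that p by (intro Cons.prems(4)) auto
  qed (use p in auto)
  ultimately show ?case using F by (simp add: m_assoc) (simp add: m_assoc[symmetric])
qed

text \<open>Otherwise finitely many open sets, each hit for only finitely many indices, would cover
  \<open>K\<close>. Indices are counted instead of points because \<open>w\<close> may repeat
  values.\<close>

lemma compact_cluster_point:
  assumes "compactin T K" "infinite N" "\<And>n. n \<in> N \<Longrightarrow> w n \<in> K"
  obtains x where "x \<in> K" "\<And>U. openin T U \<Longrightarrow> x \<in> U \<Longrightarrow> infinite {n \<in> N. w n \<in> U}"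
proof -
  have "\<exists>x\<in>K. \<forall>U. openin T U \<and> x \<in> U \<longrightarrow> infinite {n \<in> N. w n \<in> U}"
  proof (rule ccontr)
    assume "\<not> ?thesis"
    then obtain U where U: "\<And>x. x \<in> K \<Longrightarrow> openin T (U x) \<and> x \<in> U x \<and> finite {n \<in> N. w n \<in> U x}"
      by metis
    have "\<exists>F. finite F \<and> F \<subseteq> U ` K \<and> K \<subseteq> \<Union>F"
      using U by (intro compactinD[OF assms(1)]) auto
    then obtain F where F: "finite F" "F \<subseteq> U ` K" "K \<subseteq> \<Union>F" by blast
    have "N \<subseteq> (\<Union>V\<in>F. {n \<in> N. w n \<in> V})" using F assms(3) by fastforce
    moreover have "finite (\<Union>V\<in>F. {n \<in> N. w n \<in> V})" using F U by (intro finite_UN_I) auto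
    ultimately show False using \<open>infinite N\<close> finite_subset by blast
  qed
  then show ?thesis using that by blast
qed

section \<open>Neighbourhoods and limits of products\<close>

context topological_group
begin

lemma mult_nbhd:
  assumes "openin (gtop G) V" "x \<in> carrier G" "y \<in> carrier G" "x \<otimes> y \<in> V"
  obtains A B where "openin (gtop G) A" "openin (gtop G) B" "x \<in> A" "y \<in> B"
    "\<And>a b. a \<in> A \<Longrightarrow> b \<in> B \<Longrightarrow> a \<otimes> b \<in> V"
proof -
  define W where "W = {p \<in> topspace (prod_topology (gtop G) (gtop G)). (\<lambda>(x, y). x \<otimes> y) p \<in> V}"
  have "openin (prod_topology (gtop G) (gtop G)) W"
    unfolding W_def using continuous_mult assms(1) by (rule openin_continuous_map_preimage)
  moreover have "(x, y) \<in> W" using assms by (simp add: W_def topspace_gtop)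
  ultimately have "\<exists>A B. openin (gtop G) A \<and> openin (gtop G) B \<and> x \<in> A \<and> y \<in> B \<and> A \<times> B \<subseteq> W"
    by (simp add: openin_prod_topology_alt)
  then obtain A B where AB: "openin (gtop G) A" "openin (gtop G) B" "x \<in> A" "y \<in> B"
    and sub: "A \<times> B \<subseteq> W" by (elim exE conjE)
  have "a \<otimes> b \<in> V" if "a \<in> A" "b \<in> B" for a b
  proof -
    have "(a, b) \<in> W" using sub that by blast
    then show ?thesis by (simp add: W_def)
  qed
  then show ?thesis by (rule that[OF AB])
qed

lemma inv_mult_nbhd:
  assumes "openin (gtop G) V" "x \<in> carrier G" "\<one> \<in> V"
  obtains A where "openin (gtop G) A" "x \<in> A" "\<And>a b. a \<in> A \<Longrightarrow> b \<in> A \<Longrightarrow> inv a \<otimes> b \<in> V"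
proof -
  obtain A B where AB: "openin (gtop G) A" "openin (gtop G) B" "inv x \<in> A" "x \<in> B"
    "\<And>a b. a \<in> A \<Longrightarrow> b \<in> B \<Longrightarrow> a \<otimes> b \<in> V"
    by (rule mult_nbhd[OF assms(1), of "inv x" x]) (use assms in auto)
  define C where "C = {y \<in> topspace (gtop G). inv y \<in> A}"
  have "openin (gtop G) C"
    unfolding C_def using continuous_inv AB(1) by (rule openin_continuous_map_preimage)
  then have "openin (gtop G) (B \<inter> C)" using AB by blast
  moreover have "x \<in> B \<inter> C" using AB assms by (simp add: C_def topspace_gtop)
  ultimately show ?thesis using AB(5) that[of "B \<inter> C"] by (simp add: C_def)
qed

lemma limitin_mult:
  assumes "limitin (gtop G) a x F" "limitin (gtop G) b y F"
  shows "limitin (gtop G) (\<lambda>n. a n \<otimes> b n) (x \<otimes> y) F"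
proof -
  have "limitin (prod_topology (gtop G) (gtop G)) (\<lambda>n. (a n, b n)) (x, y) F"
    using assms by (simp add: limitin_pairwise o_def)
  then have "limitin (gtop G) ((\<lambda>(x, y). x \<otimes> y) \<circ> (\<lambda>n. (a n, b n))) ((\<lambda>(x, y). x \<otimes> y) (x, y)) F"
    by (rule continuous_map_limit[OF continuous_mult])
  then show ?thesis by (simp add: o_def)
qed

lemma limitin_inv:
  assumes "limitin (gtop G) a x F"
  shows "limitin (gtop G) (\<lambda>n. inv a n) (inv x) F"
  using continuous_map_limit[OF continuous_inv assms] by (simp add: o_def)

lemma closedin_finite: "finite S \<Longrightarrow> S \<subseteq> carrier G \<Longrightarrow> closedin (gtop G) S"
  using Hausdorff Hausdorff_imp_t1_space t1_space_closedin_finite topspace_gtop by blast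

end

section \<open>Homomorphisms induced by real functions\<close>

text \<open>\<open>G\<close> and \<open>H\<close> stand for the free groups on \<open>X\<close> and
  on the interval, and the last two axioms for the functor applied to maps \<open>X -> [0,1]\<close>
  and \<open>[0,1] -> [0,1]\<close>. In this form \<open>\<iota>\<close> is a function of real
  numbers, whichever object represents the interval in the category.\<close>

locale test_maps = G: topological_group G + H: topological_group H
  for G :: "'b topgroup" and H :: "'c topgroup" +
  fixes X :: "'a topology" and j :: "'a \<Rightarrow> 'b" and \<iota> :: "real \<Rightarrow> 'c"
  assumes continuous_j: "continuous_map X (gtop G) j"
    and generate_j: "generate G (j ` topspace X) = carrier G"
    and continuous_\<iota>: "continuous_map (top_of_set {0..1}) (gtop H) \<iota>"
    and inj_\<iota>: "inj_on \<iota> {0..1}"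
    and lift_exists: "\<lbrakk>continuous_map X euclideanreal f; f ` topspace X \<subseteq> {0..1}\<rbrakk> \<Longrightarrow>
      \<exists>\<Phi>\<in>hom G H. continuous_map (gtop G) (gtop H) \<Phi> \<and> (\<forall>x\<in>topspace X. \<Phi> (j x) = \<iota> (f x))"
    and act_exists: "\<lbrakk>continuous_on {0..1} \<phi>; \<phi> ` {0..1} \<subseteq> {0..1}\<rbrakk> \<Longrightarrow>
      \<exists>\<Psi>\<in>hom H H. continuous_map (gtop H) (gtop H) \<Psi> \<and> (\<forall>t\<in>{0..1}. \<Psi> (\<iota> t) = \<iota> (\<phi> t))"
begin

definition test :: "('a \<Rightarrow> real) \<Rightarrow> bool" where
  "test f \<longleftrightarrow> continuous_map X euclideanreal f \<and> f ` topspace X \<subseteq> {0..1}"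

definition lift :: "('a \<Rightarrow> real) \<Rightarrow> 'b \<Rightarrow> 'c" where
  "lift f = (SOME \<Phi>. \<Phi> \<in> hom G H \<and> continuous_map (gtop G) (gtop H) \<Phi> \<and>
     (\<forall>x\<in>topspace X. \<Phi> (j x) = \<iota> (f x)))"

definition act :: "(real \<Rightarrow> real) \<Rightarrow> 'c \<Rightarrow> 'c" where
  "act \<phi> = (SOME \<Psi>. \<Psi> \<in> hom H H \<and> continuous_map (gtop H) (gtop H) \<Psi> \<and>
     (\<forall>t\<in>{0..1}. \<Psi> (\<iota> t) = \<iota> (\<phi> t)))"

definition selfmap :: "(real \<Rightarrow> real) \<Rightarrow> bool" where
  "selfmap \<phi> \<longleftrightarrow> continuous_on {0..1} \<phi> \<and> \<phi> ` {0..1} \<subseteq> {0..1}"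

lemma lift:
  assumes "test f"
  shows lift_hom: "lift f \<in> hom G H"
    and continuous_lift: "continuous_map (gtop G) (gtop H) (lift f)"
    and lift_j: "x \<in> topspace X \<Longrightarrow> lift f (j x) = \<iota> (f x)"
proof -
  have "\<exists>\<Phi>. \<Phi> \<in> hom G H \<and> continuous_map (gtop G) (gtop H) \<Phi> \<and>
     (\<forall>x\<in>topspace X. \<Phi> (j x) = \<iota> (f x))"
    using lift_exists[of f] assms by (auto simp: test_def)
  then have "lift f \<in> hom G H \<and> continuous_map (gtop G) (gtop H) (lift f) \<and>
     (\<forall>x\<in>topspace X. lift f (j x) = \<iota> (f x))"
    unfolding lift_def by (rule someI_ex)
  then show "lift f \<in> hom G H" "continuous_map (gtop G) (gtop H) (lift f)"
    "x \<in> topspace X \<Longrightarrow> lift f (j x) = \<iota> (f x)" by auto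
qed

lemma act:
  assumes "selfmap \<phi>"
  shows act_hom: "act \<phi> \<in> hom H H"
    and continuous_act: "continuous_map (gtop H) (gtop H) (act \<phi>)"
    and act_\<iota>: "t \<in> {0..1} \<Longrightarrow> act \<phi> (\<iota> t) = \<iota> (\<phi> t)"
proof -
  have "\<exists>\<Psi>. \<Psi> \<in> hom H H \<and> continuous_map (gtop H) (gtop H) \<Psi> \<and>
     (\<forall>t\<in>{0..1}. \<Psi> (\<iota> t) = \<iota> (\<phi> t))"
    using act_exists[of \<phi>] assms unfolding selfmap_def by blast
  then have "act \<phi> \<in> hom H H \<and> continuous_map (gtop H) (gtop H) (act \<phi>) \<and>
     (\<forall>t\<in>{0..1}. act \<phi> (\<iota> t) = \<iota> (\<phi> t))"
    unfolding act_def by (rule someI_ex)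
  then show "act \<phi> \<in> hom H H" "continuous_map (gtop H) (gtop H) (act \<phi>)"
    "t \<in> {0..1} \<Longrightarrow> act \<phi> (\<iota> t) = \<iota> (\<phi> t)" by auto
qed

lemma testD: "test f \<Longrightarrow> x \<in> topspace X \<Longrightarrow> f x \<in> {0..1}"
  by (auto simp: test_def)

lemma j_closed [simp]: "x \<in> topspace X \<Longrightarrow> j x \<in> carrier G"
  using continuous_j G.topspace_gtop by (auto simp: continuous_map_def)

lemma \<iota>_closed [simp]: "t \<in> {0..1} \<Longrightarrow> \<iota> t \<in> carrier H"
  using continuous_\<iota> H.topspace_gtop by (auto simp: continuous_map_def)

lemma test_compose: "test f \<Longrightarrow> selfmap \<phi> \<Longrightarrow> test (\<lambda>x. \<phi> (f x))"
proof -
  assume f: "test f" and \<phi>: "selfmap \<phi>"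
  have "continuous_map X (top_of_set {0..1}) f"
    using f by (auto simp: test_def continuous_map_in_subtopology)
  moreover have "continuous_map (top_of_set {0..1}) euclideanreal \<phi>"
    using \<phi> by (auto simp: selfmap_def)
  ultimately have "continuous_map X euclideanreal (\<phi> \<circ> f)" by (rule continuous_map_compose)
  then show ?thesis using f \<phi> by (auto simp: test_def selfmap_def o_def)
qed

text \<open>Both sides are homomorphisms on \<open>G\<close> that agree on the generators
  \<open>j x\<close>.\<close>

lemma act_lift:
  assumes "test f" "selfmap \<phi>" "u \<in> carrier G"
  shows "act \<phi> (lift f u) = lift (\<lambda>x. \<phi> (f x)) u"
proof -
  have "compose (carrier G) (act \<phi>) (lift f) \<in> hom G H"
    using lift_hom[OF assms(1)] act_hom[OF assms(2)] by (rule G.hom_compose)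
  then have "compose (carrier G) (act \<phi>) (lift f) u = lift (\<lambda>x. \<phi> (f x)) u"
    by (rule hom_eq_on_generate[where S = "j ` topspace X", OF G.is_group H.is_group])
      (use assms lift_hom[OF test_compose] lift_j act_\<iota> testD test_compose generate_j in
        \<open>auto simp: compose_def\<close>)
  then show ?thesis using assms by (simp add: compose_def)
qed

text \<open>On a generator \<open>j x\<close> this is continuity of \<open>\<iota>\<close>; the
  elements \<open>u\<close> with this property are closed under products because multiplication in
  \<open>H\<close> is continuous. Pointwise convergence suffices since each \<open>u\<close>
  involves finitely many generators.\<close>

lemma lift_pointwise_limit:
  assumes f: "\<And>n. test (f n)" "test f'" and lim: "\<And>x. x \<in> topspace X \<Longrightarrow> (\<lambda>n. f n x) \<longlonglongrightarrow> f' x"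
    and u: "u \<in> carrier G"
  shows "limitin (gtop H) (\<lambda>n. lift (f n) u) (lift f' u) sequentially"
proof -
  interpret f': group_hom G H "lift f'"
    using lift_hom[OF f(2)] by (simp add: group_hom_def group_hom_axioms_def)
  interpret f: group_hom G H "lift (f n)" for n
    using lift_hom[OF f(1)] by (simp add: group_hom_def group_hom_axioms_def)
  have gens: "limitin (gtop H) (\<lambda>n. lift (f n) (j x)) (lift f' (j x)) sequentially"
    if x: "x \<in> topspace X" for x
  proof -
    have "limitin (top_of_set {0..1}) (\<lambda>n. f n x) (f' x) sequentially"
      using lim[OF x] testD[OF f(1) x] testD[OF f(2) x] by (simp add: limitin_subtopology)
    then have "limitin (gtop H) (\<iota> \<circ> (\<lambda>n. f n x)) (\<iota> (f' x)) sequentially"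
      by (rule continuous_map_limit[OF continuous_\<iota>])
    then show ?thesis using lift_j f x by (simp add: o_def)
  qed
  have "u \<in> generate G (j ` topspace X)" using u generate_j by simp
  then have "u \<in> carrier G \<and> limitin (gtop H) (\<lambda>n. lift (f n) u) (lift f' u) sequentially"
  proof induction
    case one
    then show ?case by (simp add: H.topspace_gtop)
  next
    case (incl h)
    then show ?case using gens by auto
  next
    case (inv h)
    then obtain x where x: "x \<in> topspace X" "h = j x" by blast
    then show ?case using H.limitin_inv[OF gens[OF x(1)]] by simp
  next
    case (eng h1 h2)
    then have h: "h1 \<in> carrier G" "h2 \<in> carrier G" by auto
    have "limitin (gtop H) (\<lambda>n. lift (f n) h1 \<otimes>\<^bsub>H\<^esub> lift (f n) h2)
        (lift f' h1 \<otimes>\<^bsub>H\<^esub> lift f' h2) sequentially"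
      using eng by (intro H.limitin_mult) auto
    then show ?case using h by simp
  qed
  then show ?thesis by simp
qed

text \<open>
  An element of \<open>G\<close> involves only finitely many generators, so that a retraction of \<open>{0..1}\<close>
  onto some \<open>{\<epsilon>..1}\<close> fixes its image; it does not fix \<open>\<iota> 0\<close>.
\<close>

lemma lift_avoids_zero:
  assumes f: "test f" and pos: "\<And>x. x \<in> topspace X \<Longrightarrow> f x > 0" and u: "u \<in> carrier G"
  shows "lift f u \<noteq> \<iota> 0"
proof -
  let ?\<phi> = "\<lambda>\<epsilon> t. max \<epsilon> t :: real"
  have self: "selfmap (?\<phi> \<epsilon>)" if "0 < \<epsilon>" "\<epsilon> \<le> 1" for \<epsilon>
    using that by (auto simp: selfmap_def intro!: continuous_intros)
  interpret f: group_hom G H "lift f"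
    using lift_hom[OF f] by (simp add: group_hom_def group_hom_axioms_def)
  have act: "group_hom H H (act (?\<phi> \<epsilon>))" if "0 < \<epsilon>" "\<epsilon> \<le> 1" for \<epsilon>
    using act_hom[OF self[OF that]] by (simp add: group_hom_def group_hom_axioms_def)
  have gens: "act (?\<phi> \<epsilon>) (\<iota> (f x)) = \<iota> (f x)" if "x \<in> topspace X" "0 < \<epsilon>" "\<epsilon> \<le> f x" for x \<epsilon>
  proof -
    have "f x \<in> {0..1}" using testD[OF f that(1)] .
    then show ?thesis using act_\<iota>[OF self, of \<epsilon> "f x"] that by (simp add: max_absorb2)
  qed
  have "u \<in> generate G (j ` topspace X)" using u generate_j by simp
  \<comment> \<open>Invariance is claimed for all small \<open>\<epsilon>\<close>, so that one
    \<open>\<epsilon>\<close> serves both factors of a product.\<close>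
  then have "u \<in> carrier G \<and>
      (\<exists>\<delta>>0. \<forall>\<epsilon>. 0 < \<epsilon> \<and> \<epsilon> \<le> \<delta> \<and> \<epsilon> \<le> 1 \<longrightarrow> act (?\<phi> \<epsilon>) (lift f u) = lift f u)"
  proof induction
    case one
    have "act (?\<phi> \<epsilon>) \<one>\<^bsub>H\<^esub> = \<one>\<^bsub>H\<^esub>" if "0 < \<epsilon>" "\<epsilon> \<le> 1" for \<epsilon>
      using act[OF that] by (rule group_hom.hom_one)
    then show ?case by (auto intro!: exI[of _ 1])
  next
    case (incl h)
    then obtain x where x: "x \<in> topspace X" "h = j x" by blast
    then show ?case
      using gens[OF x(1)] pos[OF x(1)] by (auto simp: lift_j[OF f] intro!: exI[of _ "f x"])
  next
    case (inv h)
    then obtain x where x: "x \<in> topspace X" "h = j x" by blast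
    have "act (?\<phi> \<epsilon>) (inv\<^bsub>H\<^esub> \<iota> (f x)) = inv\<^bsub>H\<^esub> \<iota> (f x)" if "0 < \<epsilon>" "\<epsilon> \<le> 1" "\<epsilon> \<le> f x" for \<epsilon>
      using group_hom.hom_inv[OF act[OF that(1,2)], of "\<iota> (f x)"] gens[OF x(1)] that
        \<iota>_closed[OF testD[OF f x(1)]] by simp
    then show ?case
      using x pos[OF x(1)] by (auto simp: lift_j[OF f] intro!: exI[of _ "f x"])
  next
    case (eng h1 h2)
    then obtain \<delta>1 \<delta>2 where \<delta>: "\<delta>1 > 0" "\<delta>2 > 0"
      "\<And>\<epsilon>. \<lbrakk>0 < \<epsilon>; \<epsilon> \<le> \<delta>1; \<epsilon> \<le> 1\<rbrakk> \<Longrightarrow> act (?\<phi> \<epsilon>) (lift f h1) = lift f h1"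
      "\<And>\<epsilon>. \<lbrakk>0 < \<epsilon>; \<epsilon> \<le> \<delta>2; \<epsilon> \<le> 1\<rbrakk> \<Longrightarrow> act (?\<phi> \<epsilon>) (lift f h2) = lift f h2"
      by blast
    have "act (?\<phi> \<epsilon>) (lift f (h1 \<otimes>\<^bsub>G\<^esub> h2)) = lift f (h1 \<otimes>\<^bsub>G\<^esub> h2)"
      if "0 < \<epsilon>" "\<epsilon> \<le> min \<delta>1 \<delta>2" "\<epsilon> \<le> 1" for \<epsilon>
    proof -
      interpret act: group_hom H H "act (?\<phi> \<epsilon>)" using act that by blast
      show ?thesis using eng.IH \<delta>(3,4)[of \<epsilon>] that by simp
    qed
    then show ?case using eng \<delta>(1,2) by (intro conjI exI[of _ "min \<delta>1 \<delta>2"]) auto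
  qed
  then obtain \<delta> where \<delta>: "\<delta> > 0"
    "\<And>\<epsilon>. 0 < \<epsilon> \<and> \<epsilon> \<le> \<delta> \<and> \<epsilon> \<le> 1 \<Longrightarrow> act (?\<phi> \<epsilon>) (lift f u) = lift f u" by blast
  define \<epsilon> where "\<epsilon> = min \<delta> 1"
  have \<epsilon>: "0 < \<epsilon>" "\<epsilon> \<le> \<delta>" "\<epsilon> \<le> 1" using \<delta>(1) by (auto simp: \<epsilon>_def)
  have "act (?\<phi> \<epsilon>) (\<iota> 0) = \<iota> \<epsilon>" using act_\<iota>[OF self[OF \<epsilon>(1,3)], of 0] \<epsilon> by simp
  moreover have "\<iota> \<epsilon> \<noteq> \<iota> 0" using inj_\<iota> \<epsilon> by (auto dest: inj_onD)
  ultimately show ?thesis using \<delta>(2)[of \<epsilon>] \<epsilon> by auto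
qed

abbreviation word :: "('a \<times> 'a) list \<Rightarrow> 'b" where
  "word ps \<equiv> alt_prod G (map (map_prod j j) ps)"

lemma word_closed: "set ps \<subseteq> topspace X \<times> topspace X \<Longrightarrow> word ps \<in> carrier G"
  by (rule G.alt_prod_closed) auto

lemma lift_word:
  assumes f: "test f" and ps: "set ps \<subseteq> topspace X \<times> topspace X"
  shows "lift f (word ps) = alt_prod H (map (map_prod \<iota> \<iota>) (map (map_prod f f) ps))"
proof -
  interpret f: group_hom G H "lift f"
    using lift_hom[OF f] by (simp add: group_hom_def group_hom_axioms_def)
  have "lift f (word ps) = alt_prod H (map (map_prod (lift f) (lift f)) (map (map_prod j j) ps))"
    by (rule f.hom_alt_prod) (use ps in auto)
  also have "map (map_prod (lift f) (lift f)) (map (map_prod j j) ps) =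
      map (map_prod \<iota> \<iota>) (map (map_prod f f) ps)"
    using ps lift_j[OF f] by (auto simp: subset_iff)
  finally show ?thesis .
qed

lemma lift_word_mult:
  assumes f: "test f" and ps: "set ps \<subseteq> topspace X \<times> topspace X" and y: "y \<in> topspace X"
  shows "lift f (word ps \<otimes>\<^bsub>G\<^esub> j y) = lift f (word ps) \<otimes>\<^bsub>H\<^esub> \<iota> (f y)"
  using lift_hom[OF f] word_closed[OF ps] y by (simp add: hom_mult lift_j[OF f])

lemma lift_word_trivial:
  assumes f: "test f" and ps: "set ps \<subseteq> topspace X \<times> topspace X" and y: "y \<in> topspace X"
    and eq: "\<And>p. p \<in> set ps \<Longrightarrow> f (fst p) = f (snd p)"
  shows "lift f (word ps \<otimes>\<^bsub>G\<^esub> j y) = \<iota> (f y)"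
proof -
  have "alt_prod H (map (map_prod \<iota> \<iota>) (map (map_prod f f) ps)) = \<one>\<^bsub>H\<^esub>"
    by (rule H.alt_prod_eq_one) (use ps testD[OF f] eq in \<open>auto simp: subset_iff\<close>)
  then show ?thesis using lift_word_mult[OF f ps y] lift_word[OF f ps] \<iota>_closed[OF testD[OF f y]] by simp
qed

end

section \<open>Words over a crowded sequence\<close>

text \<open>The sequence \<open>q\<close> may repeat values, so crowdedness asks for a different
  point and not merely for a different index.\<close>

locale separated_sequence = test_maps G H X j \<iota>
  for G :: "'b topgroup" and H :: "'c topgroup"
    and X :: "'a topology" and j :: "'a \<Rightarrow> 'b" and \<iota> :: "real \<Rightarrow> 'c" +
  fixes q :: "nat \<Rightarrow> 'a" and g :: "'a \<Rightarrow> real"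
  assumes q_in: "q i \<in> topspace X"
    and test_g: "test g"
    and inj_g: "inj_on g (range q)"
    and crowded: "\<lbrakk>openin X U; q i \<in> U\<rbrakk> \<Longrightarrow> \<exists>k. q k \<in> U \<and> q k \<noteq> q i"
begin

text \<open>A pair of points stands for the interval between their values under \<open>g\<close>.
  The value \<open>g (q k)\<close> strictly inside each interval is what allows
  \<open>cantor_function\<close> to subdivide it.\<close>

definition short_cover :: "nat \<Rightarrow> ('a \<times> 'a) list \<Rightarrow> bool" where
  "short_cover n ps \<longleftrightarrow>
     set ps \<subseteq> range q \<times> range q \<and>
     sorted_wrt (\<lambda>p p'. g (snd p) < g (fst p')) ps \<and>
     (\<forall>p\<in>set ps. \<exists>k. g (fst p) < g (q k) \<and> g (q k) < g (snd p)) \<and>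
     (\<Sum>p\<in>set ps. g (snd p) - g (fst p)) \<le> (1 / 2) ^ n \<and>
     (\<forall>i<n. \<exists>p\<in>set ps. g (fst p) \<le> g (q i) \<and> g (q i) \<le> g (snd p))"

lemma short_cover_topspace: "short_cover n ps \<Longrightarrow> set ps \<subseteq> topspace X \<times> topspace X"
  using q_in by (fastforce simp: short_cover_def)

definition near :: "real \<Rightarrow> 'a \<Rightarrow> 'a \<times> 'a \<Rightarrow> bool" where
  "near \<delta> e p \<longleftrightarrow> fst p \<in> range q \<and> snd p \<in> range q \<and>
     (\<exists>k. g (fst p) < g (q k) \<and> g (q k) < g (snd p)) \<and>
     g (fst p) \<le> g e \<and> g e \<le> g (snd p) \<and> g e - \<delta> < g (fst p) \<and> g (snd p) < g e + \<delta>"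

text \<open>Crowdedness yields two further points close to \<open>e\<close>, in the topology and
  under \<open>g\<close>. Of the three, those with extreme values form the pair and the remaining
  one provides the inner point.\<close>

lemma near_pair:
  assumes "e \<in> range q" "\<delta> > 0" "openin (gtop G) V" "\<one>\<^bsub>G\<^esub> \<in> V"
  obtains p where "near \<delta> e p" "inv\<^bsub>G\<^esub> j (fst p) \<otimes>\<^bsub>G\<^esub> j (snd p) \<in> V"
proof -
  have e: "e \<in> topspace X" using assms(1) q_in by auto
  obtain A where A: "openin (gtop G) A" "j e \<in> A"
    "\<And>a b. a \<in> A \<Longrightarrow> b \<in> A \<Longrightarrow> inv\<^bsub>G\<^esub> a \<otimes>\<^bsub>G\<^esub> b \<in> V"
    using G.inv_mult_nbhd[OF assms(3) j_closed[OF e] assms(4)] by blast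
  have cont: "continuous_map X euclideanreal g" using test_g by (simp add: test_def)
  have nbhd: "\<exists>z\<in>range q. z \<noteq> e \<and> j z \<in> A \<and> \<bar>g z - g e\<bar> < \<rho>" if "\<rho> > 0" for \<rho>
  proof -
    define U where "U = {x \<in> topspace X. j x \<in> A} \<inter> {x \<in> topspace X. g x \<in> {g e - \<rho><..<g e + \<rho>}}"
    have "openin X U"
      unfolding U_def using continuous_j A(1) cont
      by (intro openin_Int openin_continuous_map_preimage) auto
    moreover have "e \<in> U" using e A \<open>\<rho> > 0\<close> by (simp add: U_def)
    ultimately obtain k where "q k \<in> U" "q k \<noteq> e" using crowded assms(1) by blast
    then show ?thesis by (auto simp: U_def abs_less_iff intro!: bexI[of _ "q k"])
  qed
  obtain z where z: "z \<in> range q" "z \<noteq> e" "j z \<in> A" "\<bar>g z - g e\<bar> < \<delta>"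
    using nbhd[OF \<open>\<delta> > 0\<close>] by blast
  have ze: "g z \<noteq> g e" using inj_g z assms(1) by (auto dest: inj_onD)
  \<comment> \<open>Lying strictly closer to \<open>g e\<close> than \<open>g z\<close> does makes
    the three values distinct.\<close>
  obtain z' where z': "z' \<in> range q" "z' \<noteq> e" "j z' \<in> A" "\<bar>g z' - g e\<bar> < \<bar>g z - g e\<bar>"
    using nbhd[of "\<bar>g z - g e\<bar>"] ze by auto
  have ze': "g z' \<noteq> g e" using inj_g z' assms(1) by (auto dest: inj_onD)
  define Z where "Z = {e, z, z'}"
  have "\<exists>l\<in>Z. \<exists>m\<in>Z. \<exists>r\<in>Z. g l < g m \<and> g m < g r \<and> g l \<le> g e \<and> g e \<le> g r"
  proof -
    have "g z' < g e \<or> g e < g z'" "g z < g e \<or> g e < g z" using ze ze' by auto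
    then show ?thesis using z'(4) unfolding Z_def by (elim disjE) auto
  qed
  then obtain l m r where lmr: "l \<in> Z" "m \<in> Z" "r \<in> Z" "g l < g m" "g m < g r" "g l \<le> g e" "g e \<le> g r"
    by blast
  have Z: "x \<in> range q \<and> j x \<in> A \<and> \<bar>g x - g e\<bar> < \<delta>" if "x \<in> Z" for x
    using that z z' A assms(1,2) by (auto simp: Z_def)
  show ?thesis
  proof (rule that[of "(l, r)"])
    show "near \<delta> e (l, r)"
      using Z[OF lmr(1)] Z[OF lmr(2)] Z[OF lmr(3)] lmr(4-7) unfolding near_def by auto
    show "inv\<^bsub>G\<^esub> j (fst (l, r)) \<otimes>\<^bsub>G\<^esub> j (snd (l, r)) \<in> V"
      using A(3) Z lmr by simp
  qed
qed

lemma near_list: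
  assumes "set es \<subseteq> range q" "\<delta> > 0" "openin (gtop G) V" "\<one>\<^bsub>G\<^esub> \<in> V"
  shows "\<exists>ps. list_all2 (near \<delta>) es ps \<and> word ps \<in> V"
  using assms
proof (induction es arbitrary: V)
  case Nil
  then show ?case by (intro exI[of _ "[]"]) simp
next
  case (Cons e es)
  obtain A B where AB: "openin (gtop G) A" "openin (gtop G) B" "\<one>\<^bsub>G\<^esub> \<in> A" "\<one>\<^bsub>G\<^esub> \<in> B"
    "\<And>a b. a \<in> A \<Longrightarrow> b \<in> B \<Longrightarrow> a \<otimes>\<^bsub>G\<^esub> b \<in> V"
    by (rule G.mult_nbhd[OF Cons.prems(3), of "\<one>\<^bsub>G\<^esub>" "\<one>\<^bsub>G\<^esub>"]) (use Cons.prems(4) in auto)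
  have e: "e \<in> range q" and es: "set es \<subseteq> range q" using Cons.prems(1) by auto
  obtain p where p: "near \<delta> e p" "inv\<^bsub>G\<^esub> j (fst p) \<otimes>\<^bsub>G\<^esub> j (snd p) \<in> A"
    using near_pair[OF e \<open>\<delta> > 0\<close> AB(1,3)] by blast
  obtain ps where ps: "list_all2 (near \<delta>) es ps" "word ps \<in> B"
    using Cons.IH[OF es \<open>\<delta> > 0\<close> AB(2,4)] by blast
  show ?case using p ps AB(5) by (intro exI[of _ "p # ps"]) simp
qed

text \<open>Around each of the first \<open>n\<close> values a tiny interval is chosen whose factor
  is close to the unit; finitely many such factors have a product close to the unit.\<close>

lemma short_cover_near_one:
  assumes "openin (gtop G) V" "\<one>\<^bsub>G\<^esub> \<in> V"
  obtains ps where "short_cover n ps" "word ps \<in> V"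
proof -
  \<comment> \<open>Passing to the set of values removes repetitions among the first
    \<open>n\<close> terms and puts them in order.\<close>
  define T where "T = sorted_list_of_set ((\<lambda>i. g (q i)) ` {..<n})"
  define es where "es = map (inv_into (range q) g) T"
  have setT: "set T = (\<lambda>i. g (q i)) ` {..<n}" by (simp add: T_def)
  have es_q: "set es \<subseteq> range q"
    unfolding es_def set_map setT by (auto intro!: inv_into_into)
  have g_es: "map g es = T"
  proof -
    have "g (inv_into (range q) g t) = t" if "t \<in> set T" for t
      using that unfolding setT by (intro f_inv_into_f) auto
    then show ?thesis by (simp add: es_def map_idI)
  qed
  have sorted: "sorted_wrt (<) T" by (simp add: T_def)
  obtain \<gamma> where \<gamma>: "\<gamma> > 0" "\<And>s t. \<lbrakk>s \<in> set T; t \<in> set T; s < t\<rbrakk> \<Longrightarrow> \<gamma> \<le> t - s"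
  proof -
    \<comment> \<open>The extra element 1 gives the minimum a meaning when there are no two values
      to compare.\<close>
    define D where "D = insert 1 ((\<lambda>(s, t). t - s) ` {(s, t). s \<in> set T \<and> t \<in> set T \<and> s < t})"
    have "finite {(s, t). s \<in> set T \<and> t \<in> set T \<and> s < t}"
      by (rule finite_subset[of _ "set T \<times> set T"]) auto
    then have fin: "finite D" by (simp add: D_def)
    show ?thesis
    proof (rule that[of "Min D"])
      show "Min D > 0" using fin by (subst Min_gr_iff) (auto simp: D_def)
      show "Min D \<le> t - s" if "s \<in> set T" "t \<in> set T" "s < t" for s t
        using fin that by (intro Min_le) (auto simp: D_def)
    qed
  qed
  \<comment> \<open>Half the smallest gap keeps the intervals disjoint; the other bound controls
    their total length, with \<open>Suc\<close> guarding against an empty list.\<close>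
  define \<delta> where "\<delta> = min (\<gamma> / 2) ((1 / 2) ^ n / (2 * real (Suc (length T))))"
  have \<delta>: "\<delta> > 0" "2 * \<delta> \<le> \<gamma>" using \<gamma>(1) by (auto simp: \<delta>_def)
  have \<delta>_total: "real (length T) * (2 * \<delta>) \<le> (1 / 2) ^ n"
  proof -
    have "\<delta> \<le> (1 / 2) ^ n / (2 * real (Suc (length T)))" by (simp add: \<delta>_def)
    then have "\<delta> * (2 * real (Suc (length T))) \<le> (1 / 2) ^ n" by (subst (asm) pos_le_divide_eq) auto
    then show ?thesis using \<delta>(1) by (simp add: algebra_simps)
  qed
  obtain ps where ps: "list_all2 (near \<delta>) es ps" "word ps \<in> V"
    using near_list[OF es_q \<delta>(1) assms] by blast
  have len: "length ps = length T" "length es = length T"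
    using ps(1) g_es by (auto dest: list_all2_lengthD)
  have near: "near \<delta> (es ! i) (ps ! i)" if "i < length T" for i
    using ps(1) that len by (auto simp: list_all2_conv_all_nth)
  have g_nth: "g (es ! i) = T ! i" if "i < length T" for i
    using g_es that len by (metis nth_map)
  have in_ps: "\<exists>i<length T. p = ps ! i" if "p \<in> set ps" for p
    using that len by (metis in_set_conv_nth)
  have "short_cover n ps"
    unfolding short_cover_def
  proof (intro conjI ballI allI impI)
    show "set ps \<subseteq> range q \<times> range q"
    proof
      fix p assume "p \<in> set ps"
      then obtain i where "i < length T" "p = ps ! i" using in_ps by blast
      then show "p \<in> range q \<times> range q" using near[of i] by (simp add: near_def mem_Times_iff)
    qed
    show "sorted_wrt (\<lambda>p p'. g (snd p) < g (fst p')) ps"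
      unfolding sorted_wrt_iff_nth_less
    proof (intro allI impI)
      fix k l assume kl: "k < l" "l < length ps"
      have "T ! k < T ! l" using sorted kl len by (simp add: sorted_wrt_iff_nth_less)
      then have "\<gamma> \<le> T ! l - T ! k" using kl len by (intro \<gamma>) auto
      then show "g (snd (ps ! k)) < g (fst (ps ! l))"
        using near[of k] near[of l] g_nth[of k] g_nth[of l] kl len \<delta> by (auto simp: near_def)
    qed
    show "\<exists>k. g (fst p) < g (q k) \<and> g (q k) < g (snd p)" if "p \<in> set ps" for p
      using in_ps[OF that] near by (auto simp: near_def)
    have "(\<Sum>p\<in>set ps. g (snd p) - g (fst p)) \<le> (\<Sum>p\<in>set ps. 2 * \<delta>)"
    proof (rule sum_mono)
      fix p assume "p \<in> set ps"
      then obtain i where "i < length T" "p = ps ! i" using in_ps by blast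
      then show "g (snd p) - g (fst p) \<le> 2 * \<delta>" using near[of i] by (auto simp: near_def)
    qed
    also have "\<dots> = real (card (set ps)) * (2 * \<delta>)" by simp
    also have "\<dots> \<le> real (length T) * (2 * \<delta>)"
      using card_length[of ps] len \<delta>(1) by (intro mult_right_mono) auto
    finally show "(\<Sum>p\<in>set ps. g (snd p) - g (fst p)) \<le> (1 / 2) ^ n" using \<delta>_total by linarith
    show "\<exists>p\<in>set ps. g (fst p) \<le> g (q i) \<and> g (q i) \<le> g (snd p)" if "i < n" for i
    proof -
      have "g (q i) \<in> set T" using that setT by blast
      then obtain k where k: "k < length T" "T ! k = g (q i)" by (auto simp: in_set_conv_nth)
      then show ?thesis using near[of k] g_nth[of k] len
        by (intro bexI[of _ "ps ! k"]) (auto simp: near_def)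
    qed
  qed
  then show ?thesis using ps(2) that by blast
qed

text \<open>This is the form, with sets of real intervals, that \<open>collapse_intervals\<close>
  and \<open>cantor_function\<close> require. Injectivity of \<open>g\<close> on
  \<open>range q\<close> keeps the sum of lengths unchanged.\<close>

lemma short_cover_sums:
  assumes "short_cover n ps"
  defines "S \<equiv> map_prod g g ` set ps"
  shows "(\<Sum>p\<in>S. snd p - fst p) \<le> (1 / 2) ^ n"
    and "p \<in> S \<Longrightarrow> 0 \<le> fst p \<and> fst p < snd p \<and> snd p \<le> 1 \<and> snd p - fst p \<le> (1 / 2) ^ n"
    and "p \<in> S \<Longrightarrow> \<exists>k. fst p < g (q k) \<and> g (q k) < snd p"
    and "i < n \<Longrightarrow> \<exists>p\<in>S. fst p \<le> g (q i) \<and> g (q i) \<le> snd p"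
    and "p \<in> S \<Longrightarrow> p' \<in> S \<Longrightarrow> p \<noteq> p' \<Longrightarrow> snd p \<le> fst p' \<or> snd p' \<le> fst p"
proof -
  have sub: "set ps \<subseteq> range q \<times> range q"
    and sorted: "sorted_wrt (\<lambda>p p'. g (snd p) < g (fst p')) ps"
    and inner: "\<And>p. p \<in> set ps \<Longrightarrow> \<exists>k. g (fst p) < g (q k) \<and> g (q k) < g (snd p)"
    and total: "(\<Sum>p\<in>set ps. g (snd p) - g (fst p)) \<le> (1 / 2) ^ n"
    and cover: "\<And>i. i < n \<Longrightarrow> \<exists>p\<in>set ps. g (fst p) \<le> g (q i) \<and> g (q i) \<le> g (snd p)"
    using assms(1) by (auto simp: short_cover_def)
  have inj: "inj_on (map_prod g g) (set ps)"
    using map_prod_inj_on[OF inj_g inj_g] sub by (rule inj_on_subset)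
  have "(\<Sum>p\<in>S. snd p - fst p) = (\<Sum>p\<in>set ps. g (snd p) - g (fst p))"
    unfolding S_def by (subst sum.reindex[OF inj]) simp
  then show sum: "(\<Sum>p\<in>S. snd p - fst p) \<le> (1 / 2) ^ n" using total by simp
  have less: "fst p < snd p" if "p \<in> S" for p
  proof -
    obtain p' where p': "p = map_prod g g p'" "p' \<in> set ps"
      using \<open>p \<in> S\<close> unfolding S_def by (rule imageE)
    show ?thesis using inner[OF p'(2)] p'(1) by auto
  qed
  show "0 \<le> fst p \<and> fst p < snd p \<and> snd p \<le> 1 \<and> snd p - fst p \<le> (1 / 2) ^ n" if "p \<in> S" for p
  proof -
    obtain p' where p': "p = map_prod g g p'" "p' \<in> set ps"
      using \<open>p \<in> S\<close> unfolding S_def by (rule imageE)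
    have "p' \<in> topspace X \<times> topspace X" using short_cover_topspace[OF assms(1)] p'(2) by blast
    then have "g (fst p') \<in> {0..1}" "g (snd p') \<in> {0..1}"
      using testD[OF test_g] unfolding mem_Times_iff by blast+
    moreover have "snd p - fst p \<le> (\<Sum>p\<in>S. snd p - fst p)"
      using less that by (intro member_le_sum) (auto simp: S_def less_imp_le)
    ultimately show ?thesis using less[OF that] sum p' by auto
  qed
  show "\<exists>k. fst p < g (q k) \<and> g (q k) < snd p" if "p \<in> S" for p
    using that inner unfolding S_def by auto
  show "\<exists>p\<in>S. fst p \<le> g (q i) \<and> g (q i) \<le> snd p" if "i < n" for i
    using cover[OF that] unfolding S_def by auto
  show "snd p \<le> fst p' \<or> snd p' \<le> fst p" if "p \<in> S" "p' \<in> S" "p \<noteq> p'" for p p'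
  proof -
    obtain a b where ab: "a < length ps" "b < length ps"
      "p = map_prod g g (ps ! a)" "p' = map_prod g g (ps ! b)"
      using \<open>p \<in> S\<close> \<open>p' \<in> S\<close> unfolding S_def by (auto simp: in_set_conv_nth)
    have "a \<noteq> b" using ab \<open>p \<noteq> p'\<close> by auto
    then have "g (snd (ps ! a)) < g (fst (ps ! b)) \<or> g (snd (ps ! b)) < g (fst (ps ! a))"
      using sorted ab unfolding sorted_wrt_iff_nth_less by (meson linorder_neqE_nat)
    then show ?thesis using ab by auto
  qed
qed

text \<open>
  Collapsing all intervals of level at least \<open>m\<close> is a small change of \<open>g\<close> that makes almost all
  the words trivial, which determines the images of the cluster points.
\<close>

lemma lift_words_converge:
  assumes N: "infinite N" and K: "compactin (gtop G) K"
    and sc: "\<And>n. n \<in> N \<Longrightarrow> short_cover n (ps n)"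
    and y: "\<And>n. n \<in> N \<Longrightarrow> y n \<in> topspace X \<and> g (y n) = c"
    and inK: "\<And>n. n \<in> N \<Longrightarrow> word (ps n) \<otimes>\<^bsub>G\<^esub> j (y n) \<in> K"
    and W: "openin (gtop H) W" "\<iota> c \<in> W"
  shows "finite {n \<in> N. lift g (word (ps n) \<otimes>\<^bsub>G\<^esub> j (y n)) \<notin> W}"
proof (rule ccontr)
  let ?w = "\<lambda>n. word (ps n) \<otimes>\<^bsub>G\<^esub> j (y n)"
  \<comment> \<open>The exceptional indices are assumed infinite; a cluster point \<open>u\<close>
    of their words will turn out to be mapped into \<open>W\<close>.\<close>
  define N' where "N' = {n \<in> N. lift g (?w n) \<notin> W}"
  assume "infinite {n \<in> N. lift g (?w n) \<notin> W}"
  then have "infinite N'" by (simp add: N'_def)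
  have N'N: "n \<in> N" if "n \<in> N'" for n using that by (simp add: N'_def)
  obtain u where u: "u \<in> K" "\<And>U. openin (gtop G) U \<Longrightarrow> u \<in> U \<Longrightarrow> infinite {n \<in> N'. ?w n \<in> U}"
    using compact_cluster_point[OF K \<open>infinite N'\<close>, of ?w] inK N'N by blast
  have uG: "u \<in> carrier G" using u(1) compactin_subset_topspace[OF K] G.topspace_gtop by auto
  obtain n0 where "n0 \<in> N" using N by (metis finite.emptyI ex_in_conv)
  then have c: "c \<in> {0..1}" using y testD[OF test_g] by blast
  \<comment> \<open>Empty levels outside \<open>N\<close> make the hypotheses of
    \<open>collapse_intervals\<close> hold for every \<open>n\<close>.\<close>
  define S where "S n = (if n \<in> N then map_prod g g ` set (ps n) else {})" for n
  obtain \<phi> where \<phi>: "\<And>m. continuous_on UNIV (\<phi> m)" "\<And>m t. t \<in> {0..1} \<Longrightarrow> \<phi> m t \<in> {0..1}"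
    "\<And>m t. 0 \<le> t \<Longrightarrow> \<bar>\<phi> m t - t\<bar> \<le> 2 * (1 / 2) ^ m"
    "\<And>m n p. \<lbrakk>m \<le> n; p \<in> S n\<rbrakk> \<Longrightarrow> \<phi> m (fst p) = \<phi> m (snd p)"
  proof (rule collapse_intervals[of S])
    show "finite (S n)" for n by (simp add: S_def)
    show "0 \<le> fst p \<and> fst p \<le> snd p" if "p \<in> S n" for n p
    proof -
      have "n \<in> N" "p \<in> map_prod g g ` set (ps n)" using that by (auto simp: S_def split: if_splits)
      then show ?thesis using short_cover_sums(2)[OF sc] by (meson less_imp_le)
    qed
    show "(\<Sum>p\<in>S n. snd p - fst p) \<le> (1 / 2) ^ n" for n
      using short_cover_sums(1)[OF sc] by (simp add: S_def)
  qed blast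
  have self: "selfmap (\<phi> m)" for m
    using \<phi>(1)[of m] \<phi>(2) by (auto simp: selfmap_def intro: continuous_on_subset)
  have test: "test (\<lambda>x. \<phi> m (g x))" for m by (rule test_compose[OF test_g self])
  have \<phi>_lim: "(\<lambda>m. \<phi> m t) \<longlonglongrightarrow> t" if "t \<in> {0..1}" for t
  proof (rule LIM_zero_cancel, rule Lim_null_comparison)
    show "\<forall>\<^sub>F m in sequentially. norm (\<phi> m t - t) \<le> 2 * (1 / 2) ^ m" using \<phi>(3) that by auto
    have "(\<lambda>m. (1 / 2 :: real) ^ m) \<longlonglongrightarrow> 0" by (rule LIMSEQ_realpow_zero) auto
    then show "(\<lambda>m. 2 * (1 / 2 :: real) ^ m) \<longlonglongrightarrow> 0" by (rule tendsto_mult_right_zero)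
  qed
  \<comment> \<open>For fixed \<open>m\<close> the collapsed function makes every word of level
    \<open>n > m\<close> trivial, so all these elements have the image
    \<open>\<iota> (\<phi> m c)\<close>. By continuity the cluster point has it too.\<close>
  have eq: "lift (\<lambda>x. \<phi> m (g x)) u = \<iota> (\<phi> m c)" for m
  proof (rule ccontr)
    assume ne: "lift (\<lambda>x. \<phi> m (g x)) u \<noteq> \<iota> (\<phi> m c)"
    define U where "U = {v \<in> topspace (gtop G). lift (\<lambda>x. \<phi> m (g x)) v \<in> topspace (gtop H) - {\<iota> (\<phi> m c)}}"
    have "openin (gtop H) (topspace (gtop H) - {\<iota> (\<phi> m c)})"
      using \<phi>(2)[OF c] by (intro openin_diff openin_topspace H.closedin_finite) auto
    then have "openin (gtop G) U"
      unfolding U_def by (rule openin_continuous_map_preimage[OF continuous_lift[OF test]])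
    moreover have "u \<in> U"
      using ne uG lift_hom[OF test] by (auto simp: U_def G.topspace_gtop H.topspace_gtop hom_def)
    ultimately have "infinite {n \<in> N'. ?w n \<in> U}" by (rule u(2))
    then obtain n where n: "n \<in> N'" "?w n \<in> U" "n > m" by (auto simp: infinite_nat_iff_unbounded)
    have nN: "n \<in> N" using N'N n(1) by blast
    have "lift (\<lambda>x. \<phi> m (g x)) (?w n) = \<iota> (\<phi> m (g (y n)))"
    proof (rule lift_word_trivial[OF test short_cover_topspace[OF sc[OF nN]]])
      show "y n \<in> topspace X" using y nN by blast
      show "\<phi> m (g (fst p)) = \<phi> m (g (snd p))" if "p \<in> set (ps n)" for p
        using \<phi>(4)[of m n "map_prod g g p"] that n nN by (auto simp: S_def)
    qed
    then show False using n(2) y[OF nN] by (simp add: U_def)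
  qed
  \<comment> \<open>As \<open>m\<close> grows, the two sides of \<open>eq\<close> tend to
    \<open>lift g u\<close> and to \<open>\<iota> c\<close>; limits in \<open>H\<close> are
    unique.\<close>
  have "limitin (gtop H) (\<lambda>m. lift (\<lambda>x. \<phi> m (g x)) u) (lift g u) sequentially"
    by (rule lift_pointwise_limit[OF test test_g \<phi>_lim uG]) (rule testD[OF test_g])
  moreover have "limitin (gtop H) (\<lambda>m. lift (\<lambda>x. \<phi> m (g x)) u) (\<iota> c) sequentially"
  proof -
    have "limitin (top_of_set {0..1}) (\<lambda>m. \<phi> m c) c sequentially"
      using \<phi>_lim[OF c] \<phi>(2)[OF c] c by (simp add: limitin_subtopology)
    then show ?thesis
      unfolding eq using continuous_map_limit[OF continuous_\<iota>] by (fastforce simp: o_def)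
  qed
  ultimately have "lift g u = \<iota> c"
    using limitin_Hausdorff_unique[OF _ _ _ H.Hausdorff] trivial_limit_sequentially by blast
  moreover have "openin (gtop G) {v \<in> topspace (gtop G). lift g v \<in> W}"
    using continuous_lift[OF test_g] W(1) by (rule openin_continuous_map_preimage)
  \<comment> \<open>The preimage of \<open>W\<close> is a neighbourhood of \<open>u\<close> and so
    contains words with indices in \<open>N'\<close>, against the choice of
    \<open>N'\<close>.\<close>
  ultimately have "infinite {n \<in> N'. ?w n \<in> {v \<in> topspace (gtop G). lift g v \<in> W}}"
    by (intro u(2)) (use uG W(2) in \<open>simp_all add: G.topspace_gtop\<close>)
  then have "{n \<in> N'. ?w n \<in> {v \<in> topspace (gtop G). lift g v \<in> W}} \<noteq> {}" by (metis finite.emptyI)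
  then show False by (auto simp: N'_def)
qed

text \<open>
  A Cantor function constant between the intervals of infinitely many levels makes the words of
  these levels telescope to \<open>inv (\<iota> 0) \<otimes> \<iota> 1\<close>.
\<close>

lemma short_cover_words_not_compact:
  assumes N: "infinite N" and K: "compactin (gtop G) K"
    and sc: "\<And>n. n \<in> N \<Longrightarrow> short_cover n (ps n)"
    and y: "\<And>n. n \<in> N \<Longrightarrow> y n \<in> topspace X \<and> g (y n) = c"
    and inK: "\<And>n. n \<in> N \<Longrightarrow> word (ps n) \<otimes>\<^bsub>G\<^esub> j (y n) \<in> K"
  shows False
proof -
  let ?w = "\<lambda>n. word (ps n) \<otimes>\<^bsub>G\<^esub> j (y n)"
  define S where "S n = map_prod g g ` set (ps n)" for n
  have cont: "continuous_map X euclideanreal g" using test_g by (simp add: test_def)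
  \<comment> \<open>Continuity of \<open>g\<close> carries crowdedness over to the values, and
    injectivity on \<open>range q\<close> keeps them distinct.\<close>
  have crowded': "\<exists>k. g (q k) \<noteq> g (q i) \<and> \<bar>g (q k) - g (q i)\<bar> < \<epsilon>" if "\<epsilon> > 0" for i \<epsilon>
  proof -
    define U where "U = {x \<in> topspace X. g x \<in> {g (q i) - \<epsilon><..<g (q i) + \<epsilon>}}"
    have "openin X U" unfolding U_def using cont by (intro openin_continuous_map_preimage) auto
    moreover have "q i \<in> U" using q_in that by (simp add: U_def)
    ultimately obtain k where k: "q k \<in> U" "q k \<noteq> q i" using crowded by blast
    then have "g (q k) \<noteq> g (q i)" using inj_g by (auto dest: inj_onD)
    then show ?thesis using k by (auto simp: U_def abs_less_iff intro!: exI[of _ k])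
  qed
  have "\<exists>(f :: real \<Rightarrow> real) M. infinite M \<and> M \<subseteq> N \<and> continuous_on UNIV f \<and> (\<forall>t. f t \<in> {0..1}) \<and>
    (\<forall>n\<in>M. \<forall>t. (\<forall>p\<in>S n. t \<le> fst p) \<longrightarrow> f t = 0) \<and>
    (\<forall>n\<in>M. \<forall>t. (\<forall>p\<in>S n. snd p \<le> t) \<longrightarrow> f t = 1) \<and>
    (\<forall>n\<in>M. \<forall>s t. s \<le> t \<longrightarrow> (\<forall>p\<in>S n. snd p \<le> s \<or> t \<le> fst p) \<longrightarrow> f s = f t)"
  proof (rule cantor_function[where S = S and N = N and e = "\<lambda>i. g (q i)"])
    show "\<exists>k. g (q k) \<noteq> g (q i) \<and> \<bar>g (q k) - g (q i)\<bar> < \<epsilon>" if "\<epsilon> > 0" for i \<epsilon>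
      using that by (rule crowded')
    show "fst p < snd p \<and> snd p - fst p \<le> (1 / 2) ^ n" if "n \<in> N" "p \<in> S n" for n p
      using short_cover_sums(2)[OF sc[OF that(1)], of p] that(2) unfolding S_def by simp
    show "\<exists>k. fst p < g (q k) \<and> g (q k) < snd p" if "n \<in> N" "p \<in> S n" for n p
      using short_cover_sums(3)[OF sc[OF that(1)], of p] that(2) unfolding S_def by simp
    show "\<exists>p\<in>S n. fst p \<le> g (q i) \<and> g (q i) \<le> snd p" if "n \<in> N" "i < n" for n i
      using short_cover_sums(4)[OF sc[OF that(1)] that(2)] unfolding S_def .
    show "snd p \<le> fst p' \<or> snd p' \<le> fst p" if "n \<in> N" "p \<in> S n" "p' \<in> S n" "p \<noteq> p'" for n p p'
      using short_cover_sums(5)[OF sc[OF that(1)], of p p'] that(2-) unfolding S_def by simp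
  qed (rule N)
  then obtain f :: "real \<Rightarrow> real" and M
    where M: "infinite M" "M \<subseteq> N" and f: "continuous_on UNIV f" "\<And>t. f t \<in> {0..1}"
      and f0: "\<forall>n\<in>M. \<forall>t. (\<forall>p\<in>S n. t \<le> fst p) \<longrightarrow> f t = 0"
      and f1: "\<forall>n\<in>M. \<forall>t. (\<forall>p\<in>S n. snd p \<le> t) \<longrightarrow> f t = 1"
      and fc: "\<forall>n\<in>M. \<forall>s t. s \<le> t \<longrightarrow> (\<forall>p\<in>S n. snd p \<le> s \<or> t \<le> fst p) \<longrightarrow> f s = f t"
    by (elim exE conjE) simp
  have self: "selfmap f" using f by (auto simp: selfmap_def intro: continuous_on_subset)
  have test: "test (\<lambda>x. f (g x))" by (rule test_compose[OF test_g self])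
  obtain n0 where n0: "n0 \<in> M" using M(1) by (metis finite.emptyI ex_in_conv)
  then have c: "c \<in> {0..1}" using y testD[OF test_g] M(2) by blast
  have i01 [simp]: "\<iota> 0 \<in> carrier H" "\<iota> 1 \<in> carrier H" by auto
  let ?h = "inv\<^bsub>H\<^esub> \<iota> 0 \<otimes>\<^bsub>H\<^esub> \<iota> 1"
  have fcH: "\<iota> (f c) \<in> carrier H" using f(2) by (rule \<iota>_closed)
  \<comment> \<open>For all selected levels the image is one and the same element, which differs
    from \<open>\<iota> (f c)\<close> by the factor \<open>?h\<close>.\<close>
  have telescope: "act f (lift g (?w n)) = ?h \<otimes>\<^bsub>H\<^esub> \<iota> (f c)" if "n \<in> M" for n
  proof -
    have nN: "n \<in> N" using that M(2) by blast
    have top: "set (ps n) \<subseteq> topspace X \<times> topspace X" by (rule short_cover_topspace[OF sc[OF nN]])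
    have yn: "y n \<in> topspace X" "g (y n) = c" using y nN by auto
    define L where "L = map (map_prod g g) (ps n)"
    have L: "set L = S n" by (simp add: L_def S_def)
    have bounds: "0 \<le> fst p \<and> fst p < snd p \<and> snd p \<le> 1" if "p \<in> S n" for p
      using short_cover_sums(2)[OF sc[OF nN]] that unfolding S_def by blast
    have "alt_prod H (map (map_prod (\<lambda>t. \<iota> (f t)) (\<lambda>t. \<iota> (f t))) L) =
        inv\<^bsub>H\<^esub> \<iota> (f 0) \<otimes>\<^bsub>H\<^esub> \<iota> (f 1)"
    proof (rule H.alt_prod_telescope)
      show "\<iota> (f t) \<in> carrier H" for t using f(2) by (rule \<iota>_closed)
      show "sorted_wrt (\<lambda>p p'. snd p < fst p') L"
        using sc[OF nN] by (simp add: L_def short_cover_def sorted_wrt_map)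
      show "0 \<le> fst p \<and> fst p \<le> snd p \<and> snd p \<le> 1" if "p \<in> set L" for p
        using bounds[of p] that L by auto
      show "\<iota> (f s) = \<iota> (f t)" if "s \<le> t" "\<And>p. p \<in> set L \<Longrightarrow> snd p \<le> s \<or> t \<le> fst p" for s t
        using fc \<open>n \<in> M\<close> that L by simp
    qed simp
    moreover have "f 0 = 0" using f0 \<open>n \<in> M\<close> bounds by simp
    moreover have "f 1 = 1" using f1 \<open>n \<in> M\<close> bounds by simp
    moreover have "map (map_prod (\<lambda>t. \<iota> (f t)) (\<lambda>t. \<iota> (f t))) L =
        map (map_prod \<iota> \<iota>) (map (map_prod (\<lambda>x. f (g x)) (\<lambda>x. f (g x))) (ps n))"
      by (auto simp: L_def)
    ultimately have "lift (\<lambda>x. f (g x)) (word (ps n)) = ?h"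
      using lift_word[OF test top] by simp
    moreover have "?w n \<in> carrier G" using word_closed[OF top] yn by simp
    ultimately show ?thesis
      using act_lift[OF test_g self] lift_word_mult[OF test top yn(1)] yn(2) by simp
  qed
  \<comment> \<open>This neighbourhood of \<open>\<iota> c\<close> excludes the words of every level
    in \<open>M\<close>, because \<open>act f\<close> sends \<open>\<iota> c\<close> to
    \<open>\<iota> (f c)\<close> and \<open>?h\<close> is not the unit.\<close>
  define W where "W = {v \<in> topspace (gtop H). act f v \<in> topspace (gtop H) - {?h \<otimes>\<^bsub>H\<^esub> \<iota> (f c)}}"
  have "openin (gtop H) (topspace (gtop H) - {?h \<otimes>\<^bsub>H\<^esub> \<iota> (f c)})"
    using fcH by (intro openin_diff openin_topspace H.closedin_finite) auto
  then have openW: "openin (gtop H) W"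
    unfolding W_def by (rule openin_continuous_map_preimage[OF continuous_act[OF self]])
  have cW: "\<iota> c \<in> W"
  proof -
    have "?h \<noteq> \<one>\<^bsub>H\<^esub>"
    proof
      assume "?h = \<one>\<^bsub>H\<^esub>"
      moreover have "\<iota> 1 = \<iota> 0 \<otimes>\<^bsub>H\<^esub> ?h" by (simp add: H.m_assoc[symmetric])
      ultimately have "\<iota> 1 = \<iota> 0" by simp
      then show False using inj_\<iota> by (auto dest: inj_onD)
    qed
    then have "?h \<otimes>\<^bsub>H\<^esub> \<iota> (f c) \<noteq> \<iota> (f c)"
      using fcH H.r_cancel_one[of "\<iota> (f c)" ?h] by simp
    then show ?thesis
      using act_\<iota>[OF self c] fcH \<iota>_closed[OF c] by (auto simp: W_def H.topspace_gtop)
  qed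
  have "finite {n \<in> N. lift g (?w n) \<notin> W}"
    by (rule lift_words_converge[OF N K _ _ _ openW cW]) (fact sc y inK)+
  moreover have "M \<subseteq> {n \<in> N. lift g (?w n) \<notin> W}"
    using telescope M(2) by (auto simp: W_def)
  ultimately show False using M(1) finite_subset by blast
qed

end

section \<open>The k-space property\<close>

context test_maps
begin

theorem locally_compact_or_scattered:
  assumes "metrizable_space X" and k: "k_space (gtop G)"
  shows "locally_compact_space X \<or> scattered_space X"
proof (rule ccontr)
  assume contra: "\<not> ?thesis"
  obtain M d where "Metric_space M d" and Xeq: "X = Metric_space.mtopology M d"
    using assms(1) by (auto simp: metrizable_space_def)
  then interpret Metric_space M d by simp
  have topX [simp]: "topspace X = M" by (simp add: Xeq)
  obtain a where a: "a \<in> M"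
    and \<sigma>_ex: "\<And>r. r > 0 \<Longrightarrow> \<exists>\<sigma>::nat \<Rightarrow> 'a. range \<sigma> \<subseteq> mball a r - {a} \<and>
      (\<forall>x\<in>M. \<exists>\<delta>>0. \<forall>n. \<delta> \<le> d x (\<sigma> n) + (1 / 2) ^ n)"
    using not_locally_compact_point contra Xeq by blast

  \<comment> \<open>A crowded sequence at positive distance from \<open>a\<close>\<close>
  obtain S0 where S0: "S0 \<subseteq> M" "S0 \<noteq> {}" "\<And>x. x \<in> S0 \<Longrightarrow> \<not> openin (subtopology X S0) {x}"
    using contra by (auto simp: scattered_space_def)
  have "S0 \<noteq> {a}"
  proof
    assume "S0 = {a}"
    then have "openin (subtopology X S0) {a}"
      using openin_topspace[of "subtopology X S0"] a by simp
    then show False using S0(3)[of a] \<open>S0 = {a}\<close> by simp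
  qed
  then obtain s where s: "s \<in> S0" "s \<noteq> a" using S0(2) by blast
  have sM: "s \<in> M" using s S0 by blast
  \<comment> \<open>The third leaves \<open>2 * r\<close> below the distance from \<open>a\<close>
    to \<open>s\<close>; the cap 1/2 is required by \<open>separating_function\<close>.\<close>
  define r where "r = min (1 / 2) (d a s / 3)"
  have das: "d a s > 0" using s a sM by auto
  have r: "0 < r" "r \<le> 1 / 2" "2 * r < d a s" using das by (auto simp: r_def)
  \<comment> \<open>Cutting a closed ball around \<open>a\<close> out of the crowded set
    \<open>S0\<close> leaves a relatively open part, which is again crowded.\<close>
  define S where "S = {x \<in> S0. 2 * r < d a x}"
  have SM: "S \<subseteq> M" using S0 by (auto simp: S_def)
  have crowdedS: "\<exists>y\<in>S. y \<noteq> x \<and> d y x < \<epsilon>" if x: "x \<in> S" and "\<epsilon> > 0" for x \<epsilon>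
  proof (rule ccontr)
    assume none: "\<not> ?thesis"
    have xM: "x \<in> M" and xS0: "x \<in> S0" and dx: "2 * r < d a x" using x SM by (auto simp: S_def)
    define \<rho> where "\<rho> = min \<epsilon> (d a x - 2 * r)"
    have \<rho>: "\<rho> > 0" using \<open>\<epsilon> > 0\<close> dx by (simp add: \<rho>_def)
    have "S0 \<inter> mball x \<rho> = {x}"
    proof
      show "{x} \<subseteq> S0 \<inter> mball x \<rho>" using xS0 xM \<rho> by auto
      show "S0 \<inter> mball x \<rho> \<subseteq> {x}"
      proof
        fix y assume y: "y \<in> S0 \<inter> mball x \<rho>"
        then have yM: "y \<in> M" and dxy: "d x y < \<rho>" by auto
        have "d a x \<le> d a y + d x y" using triangle[OF a yM xM] by (simp add: commute)
        then have "y \<in> S" using y dxy by (simp add: S_def \<rho>_def)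
        moreover have "d y x < \<epsilon>" using dxy by (simp add: \<rho>_def commute)
        ultimately show "y \<in> {x}" using none by blast
      qed
    qed
    moreover have "openin (subtopology X S0) (S0 \<inter> mball x \<rho>)"
      using openin_mball[of x \<rho>] by (auto simp: openin_subtopology Xeq)
    ultimately show False using S0(3)[OF xS0] by simp
  qed
  have "s \<in> S" using s r by (simp add: S_def)
  then obtain q :: "nat \<Rightarrow> 'a" where q: "range q \<subseteq> S"
    and q_crowded: "\<And>i \<epsilon>. \<epsilon> > 0 \<Longrightarrow> \<exists>k. q k \<noteq> q i \<and> d (q k) (q i) < \<epsilon>"
    using countable_crowded_sequence[OF SM _ crowdedS] by blast
  have qM: "q i \<in> M" for i using q SM by blast
  have aq: "2 * r < d a (q i)" for i using q by (auto simp: S_def)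
  have far: "r \<le> d x (q i)" if "x \<in> M" "d a x < r" for x i
    using triangle[OF a that(1) qM, of i] aq[of i] that(2) by linarith
  obtain g where g: "continuous_map mtopology euclideanreal g" "\<And>x. g x \<in> {0..1}"
    "inj_on g (range q)"
    "\<And>x y. \<lbrakk>\<And>i. r \<le> d x (q i); \<And>i. r \<le> d y (q i)\<rbrakk> \<Longrightarrow> g x = g y"
    using separating_function[of q r] qM r by blast
  have ga: "g x = g a" if "x \<in> M" "d a x < r" for x
    using far[OF that] far[OF a] a r by (intro g(4)) auto
  interpret sq: separated_sequence G H X j \<iota> q g
  proof unfold_locales
    show "q i \<in> topspace X" for i using qM by simp
    show "test g" unfolding test_def using g by (auto simp: Xeq)
    show "inj_on g (range q)" by (rule g)
    show "\<exists>k. q k \<in> U \<and> q k \<noteq> q i" if "openin X U" "q i \<in> U" for U i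
    proof -
      obtain \<epsilon> where \<epsilon>: "\<epsilon> > 0" "mball (q i) \<epsilon> \<subseteq> U" using \<open>openin X U\<close> \<open>q i \<in> U\<close>
        unfolding Xeq openin_mtopology by blast
      obtain k where "q k \<noteq> q i" "d (q k) (q i) < \<epsilon>" using q_crowded[OF \<epsilon>(1)] by blast
      then have "q k \<in> U" using \<epsilon>(2) qM commute by auto
      then show ?thesis using \<open>q k \<noteq> q i\<close> by blast
    qed
  qed

  \<comment> \<open>Products of words with points near \<open>a\<close>\<close>
  define R where "R n = min r (1 / real (Suc n))" for n
  have R: "R n > 0" "R n \<le> r" for n using r by (auto simp: R_def)
  \<comment> \<open>Radii tending to 0 let the points approach \<open>a\<close> as \<open>n\<close>
    grows; the cap \<open>r\<close> keeps them where \<open>g\<close> is constant.\<close>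
  obtain \<sigma> :: "nat \<Rightarrow> nat \<Rightarrow> 'a" where \<sigma>: "\<And>n. range (\<sigma> n) \<subseteq> mball a (R n) - {a}"
    and \<sigma>_discrete: "\<And>n x. x \<in> M \<Longrightarrow> \<exists>\<delta>>0. \<forall>m. \<delta> \<le> d x (\<sigma> n m) + (1 / 2) ^ m"
    using \<sigma>_ex[OF R(1)] by metis
  have \<sigma>M: "\<sigma> n m \<in> M" and \<sigma>a: "\<sigma> n m \<noteq> a" and \<sigma>R: "d a (\<sigma> n m) < R n" for n m
    using \<sigma>[of n] by (auto simp: subset_iff)
  have \<sigma>r: "d a (\<sigma> n m) < r" for n m using \<sigma>R[of n m] R(2)[of n] by linarith
  \<comment> \<open>Distinct lists receive distinct indices in the sequence
    \<open>\<sigma> n\<close>, so infinitely many lists of one level use unboundedly large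
    indices.\<close>
  define code where "code = to_nat_on (lists (range q \<times> range q))"
  have "inj_on code (lists (range q \<times> range q))"
    unfolding code_def by (intro inj_on_to_nat_on countable_lists countable_SIGMA) auto
  then have code: "inj_on code {ps. sq.short_cover n ps}" for n
    by (rule inj_on_subset) (auto simp: sq.short_cover_def lists_eq_set)
  let ?y = "\<lambda>n ps. \<sigma> n (code ps)"
  let ?w = "\<lambda>n ps. word ps \<otimes>\<^bsub>G\<^esub> j (?y n ps)"
  define A where "A n = ?w n ` {ps. sq.short_cover n ps}" for n
  have top: "set ps \<subseteq> topspace X \<times> topspace X" if "sq.short_cover n ps" for n ps
    by (rule sq.short_cover_topspace[OF that])
  have wG: "?w n ps \<in> carrier G" if "sq.short_cover n ps" for n ps
    using word_closed[OF top[OF that]] \<sigma>M by simp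
  \<comment> \<open>A test function that is constant on the letters detects only the last
    factor.\<close>
  have const: "lift f (?w n ps) = \<iota> (f (?y n ps))"
    if "test f" "\<And>i. f (q i) = t" "sq.short_cover n ps" for f n ps t
  proof (rule lift_word_trivial[OF that(1) top[OF that(3)]])
    show "?y n ps \<in> topspace X" using \<sigma>M by simp
    show "f (fst p) = f (snd p)" if "p \<in> set ps" for p
    proof -
      have "p \<in> range q \<times> range q" using that \<open>sq.short_cover n ps\<close> by (auto simp: sq.short_cover_def)
      then show ?thesis using \<open>\<And>i. f (q i) = t\<close> by auto
    qed
  qed

  \<comment> \<open>Finiteness on compact sets\<close>
  have fin1: "finite {n. K \<inter> A n \<noteq> {}}" if K: "compactin (gtop G) K" for K
  proof (rule ccontr)
    assume inf: "infinite {n. K \<inter> A n \<noteq> {}}"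
    have "\<exists>ps. sq.short_cover n ps \<and> ?w n ps \<in> K" if "n \<in> {n. K \<inter> A n \<noteq> {}}" for n
      using that by (auto simp: A_def)
    then obtain ps where ps: "\<And>n. n \<in> {n. K \<inter> A n \<noteq> {}} \<Longrightarrow> sq.short_cover n (ps n) \<and> ?w n (ps n) \<in> K"
      by metis
    \<comment> \<open>The appended points lie within \<open>r\<close> of \<open>a\<close>, where
      \<open>g\<close> takes the single value \<open>g a\<close>.\<close>
    show False
      by (rule sq.short_cover_words_not_compact[OF inf K, of ps "\<lambda>n. ?y n (ps n)" "g a"])
        (use ps \<sigma>M \<sigma>r ga in auto)
  qed
  have fin2: "finite (K \<inter> A n)" if K: "compactin (gtop G) K" for K n
  proof (rule ccontr)
    assume inf: "infinite (K \<inter> A n)"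
    define B where "B = {ps. sq.short_cover n ps \<and> ?w n ps \<in> K}"
    have "K \<inter> A n \<subseteq> ?w n ` B" by (auto simp: A_def B_def)
    then have "infinite B" using inf by (meson finite_imageI finite_subset)
    then have "infinite (code ` B)"
      using code[of n] by (subst finite_image_iff) (auto simp: B_def intro: inj_on_subset)
    obtain f where f: "continuous_map mtopology euclideanreal f"
      "\<And>x. x \<in> M \<Longrightarrow> 0 < f x \<and> f x \<le> r" "\<And>m. f (\<sigma> n m) \<le> (1 / 2) ^ m"
      "\<And>x. \<lbrakk>x \<in> M; \<And>m. r \<le> d x (\<sigma> n m)\<rbrakk> \<Longrightarrow> f x = r"
      by (rule escape_function[of "\<sigma> n" r, OF _ r(1) \<sigma>_discrete]) (use \<sigma>M in auto)
    have test: "test f" using f(1,2) r(2) unfolding test_def by (fastforce simp: Xeq)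
    have fq: "f (q i) = r" for i
      using far[OF \<sigma>M \<sigma>r] by (intro f(4) qM) (simp add: commute)
    have cl: "closedin (gtop H) (lift f ` K)"
      by (intro compactin_imp_closedin H.Hausdorff image_compactin[OF K] continuous_lift test)
    have "\<iota> 0 \<notin> lift f ` K"
      using lift_avoids_zero[OF test] f(2) compactin_subset_topspace[OF K] G.topspace_gtop
      by (metis imageE subsetD topX)
    then have zero: "\<iota> 0 \<in> topspace (gtop H) - lift f ` K" by (simp add: H.topspace_gtop)
    define Z where "Z = {t \<in> topspace (top_of_set {0..1}). \<iota> t \<in> topspace (gtop H) - lift f ` K}"
    have "openin (top_of_set {0..1}) Z"
      unfolding Z_def using continuous_\<iota> cl by (intro openin_continuous_map_preimage) auto
    moreover have "0 \<in> Z" using zero by (simp add: Z_def)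
    ultimately obtain \<delta> where \<delta>: "\<delta> > 0" "\<And>t. \<lbrakk>t \<in> {0..1}; dist t 0 < \<delta>\<rbrakk> \<Longrightarrow> t \<in> Z"
      unfolding openin_euclidean_subtopology_iff by blast
    obtain m where m: "(1 / 2) ^ m < \<delta>" using real_arch_pow_inv[OF \<delta>(1), of "1 / 2"] by auto
    obtain ps where ps: "ps \<in> B" "code ps > m"
      using \<open>infinite (code ` B)\<close> by (auto simp: infinite_nat_iff_unbounded)
    have "f (?y n ps) \<le> (1 / 2) ^ code ps" by (rule f(3))
    also have "\<dots> \<le> (1 / 2) ^ m" using ps(2) by (intro power_decreasing) auto
    finally have "f (?y n ps) < \<delta>" using m by linarith
    moreover have "0 < f (?y n ps)" "f (?y n ps) \<le> 1" using f(2)[OF \<sigma>M, of n "code ps"] r(2) by auto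
    ultimately have "\<iota> (f (?y n ps)) \<notin> lift f ` K" using \<delta>(2)[of "f (?y n ps)"] by (simp add: Z_def)
    moreover have "lift f (?w n ps) = \<iota> (f (?y n ps))"
      by (rule const[OF test fq]) (use ps in \<open>simp add: B_def\<close>)
    moreover have "lift f (?w n ps) \<in> lift f ` K" using ps(1) by (intro imageI) (simp add: B_def)
    ultimately show False by simp
  qed
  \<comment> \<open>The union meets every compact set in a finite, hence closed, set; the k-space
    property makes it closed.\<close>
  have closed: "closedin (gtop G) (\<Union>n. A n)"
  proof -
    have sub: "(\<Union>n. A n) \<subseteq> carrier G" using wG by (auto simp: A_def)
    have "closedin (subtopology (gtop G) K) (K \<inter> (\<Union>n. A n))" if K: "compactin (gtop G) K" for K
    proof -
      have "finite (\<Union>n\<in>{n. K \<inter> A n \<noteq> {}}. K \<inter> A n)"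
        using fin1[OF K] fin2[OF K] by (intro finite_UN_I)
      also have "(\<Union>n\<in>{n. K \<inter> A n \<noteq> {}}. K \<inter> A n) = K \<inter> (\<Union>n. A n)" by blast
      finally have "finite (K \<inter> (\<Union>n. A n))" .
      then have "closedin (gtop G) (K \<inter> (\<Union>n. A n))" using sub by (intro G.closedin_finite) auto
      then show ?thesis by (intro closedin_subset_topspace) auto
    qed
    then show ?thesis using k sub unfolding k_space by (metis G.topspace_gtop)
  qed

  \<comment> \<open>The accumulation point \<open>j a\<close>\<close>
  have notin: "j a \<notin> (\<Union>n. A n)"
  proof
    assume "j a \<in> (\<Union>n. A n)"
    then obtain n ps where ps: "sq.short_cover n ps" "j a = ?w n ps" by (auto simp: A_def)
    \<comment> \<open>This test function is constant on the sequence \<open>q\<close> and vanishes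
      only at \<open>a\<close>, so it distinguishes \<open>a\<close> from all appended
      points.\<close>
    define f where "f x = min r (d a x)" for x
    have "continuous_map mtopology euclideanreal f"
    proof (rule lipschitz_continuous_map[where C = 1])
      show "f x \<le> f y + 1 * d x y" if "x \<in> M" "y \<in> M" for x y
        using triangle[OF a that(2) that(1)] nonneg[of x y] commute[of x y] unfolding f_def by linarith
    qed simp
    then have test: "test f" using r unfolding test_def by (auto simp: Xeq f_def)
    have fq: "f (q i) = r" for i using aq[of i] r by (simp add: f_def)
    have "\<iota> (f a) = \<iota> (f (?y n ps))"
      using const[OF test fq ps(1)] lift_j[OF test, of a] a unfolding ps(2)[symmetric] by simp
    moreover have "f a = 0" using a r by (simp add: f_def)
    moreover have "0 < f (?y n ps)" "f (?y n ps) \<le> 1" using \<sigma>M \<sigma>a a r by (auto simp: f_def)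
    ultimately show False using inj_\<iota> by (auto dest: inj_onD)
  qed
  have compl: "openin (gtop G) (topspace (gtop G) - (\<Union>n. A n))" using closed by blast
  \<comment> \<open>Written as a product, \<open>j a\<close> has a neighbourhood that splits into
    one of the unit for the words and one of \<open>j a\<close> for the appended points.\<close>
  have "\<one>\<^bsub>G\<^esub> \<otimes>\<^bsub>G\<^esub> j a \<in> topspace (gtop G) - (\<Union>n. A n)"
    using notin a by (simp add: G.topspace_gtop)
  then obtain V V' where V: "openin (gtop G) V" "openin (gtop G) V'" "\<one>\<^bsub>G\<^esub> \<in> V" "j a \<in> V'"
    "\<And>u v. u \<in> V \<Longrightarrow> v \<in> V' \<Longrightarrow> u \<otimes>\<^bsub>G\<^esub> v \<in> topspace (gtop G) - (\<Union>n. A n)"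
    by (rule G.mult_nbhd[OF compl G.one_closed j_closed, rotated]) (use a in simp_all)
  have "openin X {x \<in> topspace X. j x \<in> V'}"
    using continuous_j V(2) by (rule openin_continuous_map_preimage)
  then obtain \<epsilon> where \<epsilon>: "\<epsilon> > 0" "mball a \<epsilon> \<subseteq> {x \<in> topspace X. j x \<in> V'}"
    using V(4) a unfolding Xeq openin_mtopology by (auto simp: Xeq)
  \<comment> \<open>The level is chosen so that all of \<open>\<sigma> n\<close> lies in the ball;
    words of this same level exist arbitrarily close to the unit.\<close>
  obtain n where n: "1 / real (Suc n) < \<epsilon>"
    using reals_Archimedean[OF \<epsilon>(1)] by (auto simp: inverse_eq_divide)
  obtain ps where ps: "sq.short_cover n ps" "word ps \<in> V"
    using sq.short_cover_near_one[OF V(1,3)] by blast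
  have "R n < \<epsilon>" using n by (simp add: R_def)
  then have "?y n ps \<in> mball a \<epsilon>" using \<sigma>R[of n "code ps"] a \<sigma>M by simp
  then have "j (?y n ps) \<in> V'" using \<epsilon>(2) by blast
  then have "?w n ps \<notin> (\<Union>n. A n)" using V(5)[OF ps(2)] by blast
  then show False using ps(1) by (auto simp: A_def)
qed

end

text \<open>Composition with \<open>\<theta>\<close> turns a test function into a morphism to
  \<open>J\<close>, and conjugation with the homeomorphism turns a self-map of the interval into one
  of \<open>J\<close>. The required homomorphisms are the values of \<open>Fm\<close> on these,
  restricted to be extensional.\<close>

lemma (in minimal_free_topological_group_functor) test_maps:
  assumes "X \<in> Ob" "J \<in> Ob" and "homeomorphic_maps J (top_of_set {0..1::real}) \<eta> \<theta>"
  shows "test_maps (F X) (F J) X (i X) (\<lambda>t. i J (\<theta> t))"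
proof -
  interpret G: topological_group "F X" by (rule F_object) fact
  interpret H: topological_group "F J" by (rule F_object) fact
  have \<eta>: "continuous_map J (top_of_set {0..1}) \<eta>" and \<theta>: "continuous_map (top_of_set {0..1}) J \<theta>"
    and \<eta>\<theta>: "\<And>t. t \<in> {0..1} \<Longrightarrow> \<eta> (\<theta> t) = t"
    using assms(3) by (auto simp: homeomorphic_maps_def)
  have emb: "continuous_map Y (gtop (F Y)) (i Y)" "inj_on (i Y) (topspace Y)" if "Y \<in> Ob" for Y
    using i_embedding[OF that] unfolding embedding_map_def
    by (auto dest: homeomorphic_imp_continuous_map homeomorphic_imp_injective_map
        simp: continuous_map_in_subtopology)
  have \<theta>J: "\<theta> t \<in> topspace J" if "t \<in> {0..1}" for t
    using continuous_map_image_subset_topspace[OF \<theta>] that by auto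
  have hom: "restrict (\<theta> \<circ> f) (topspace Y) \<in> top_hom Y J"
    if "continuous_map Y (top_of_set {0..1}) f" for Y and f :: "'a \<Rightarrow> real"
    using continuous_map_compose[OF that \<theta>] by (auto simp: top_hom_def intro: continuous_map_eq)
  show ?thesis
  proof unfold_locales
    show "continuous_map X (gtop (F X)) (i X)" by (rule emb) fact
    show "generate (F X) (i X ` topspace X) = carrier (F X)" by (rule generated) fact
    show "continuous_map (top_of_set {0..1}) (gtop (F J)) (\<lambda>t. i J (\<theta> t))"
      using continuous_map_compose[OF \<theta> emb(1)[OF \<open>J \<in> Ob\<close>]] by (simp add: o_def)
    show "inj_on (\<lambda>t. i J (\<theta> t)) {0..1}"
      using emb(2)[OF \<open>J \<in> Ob\<close>] \<theta>J \<eta>\<theta> by (intro inj_onI) (metis inj_onD)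
    show "\<exists>\<Phi>\<in>hom (F X) (F J). continuous_map (gtop (F X)) (gtop (F J)) \<Phi> \<and>
        (\<forall>x\<in>topspace X. \<Phi> (i X x) = i J (\<theta> (f x)))"
      if "continuous_map X euclideanreal f" "f ` topspace X \<subseteq> {0..1}" for f
    proof -
      have h: "restrict (\<theta> \<circ> f) (topspace X) \<in> top_hom X J"
        using that by (intro hom) (auto simp: continuous_map_in_subtopology)
      show ?thesis
        using Fm_hom[OF assms(1,2) h] Fm_continuous[OF assms(1,2) h] i_natural[OF assms(1,2) h]
        by (intro bexI[of _ "Fm X J (restrict (\<theta> \<circ> f) (topspace X))"]) auto
    qed
    show "\<exists>\<Psi>\<in>hom (F J) (F J). continuous_map (gtop (F J)) (gtop (F J)) \<Psi> \<and>
        (\<forall>t\<in>{0..1}. \<Psi> (i J (\<theta> t)) = i J (\<theta> (\<phi> t)))"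
      if "continuous_on {0..1} \<phi>" "\<phi> ` {0..1} \<subseteq> {0..1}" for \<phi>
    proof -
      have "continuous_map (top_of_set {0..1}) (top_of_set {0..1}) \<phi>"
        using that by (auto simp: continuous_map_in_subtopology)
      then have h: "restrict (\<theta> \<circ> (\<phi> \<circ> \<eta>)) (topspace J) \<in> top_hom J J"
        by (intro hom continuous_map_compose[OF \<eta>])
      show ?thesis
        using Fm_hom[OF assms(2,2) h] Fm_continuous[OF assms(2,2) h] i_natural[OF assms(2,2) h] \<theta>J \<eta>\<theta>
        by (intro bexI[of _ "Fm J J (restrict (\<theta> \<circ> (\<phi> \<circ> \<eta>)) (topspace J))"]) auto
    qed
  qed
qed

text \<open>All objects are topologies on the type \<open>'a\<close>, so the unit interval is
  represented by an object \<open>J\<close> homeomorphic to it.\<close>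

theorem corollary1:
  fixes Ob :: "'a topology set"
    and F :: "'a topology \<Rightarrow> 'b topgroup"
    and Fm :: "'a topology \<Rightarrow> 'a topology \<Rightarrow> ('a \<Rightarrow> 'a) \<Rightarrow> 'b \<Rightarrow> 'b"
    and i :: "'a topology \<Rightarrow> 'a \<Rightarrow> 'b"
    and J X Xbar :: "'a topology"
    and e :: "'a \<Rightarrow> 'a"
  assumes "J \<in> Ob" and "J homeomorphic_space top_of_set {0..1::real}"
    and "minimal_free_topological_group_functor Ob F Fm i"
    and "X \<in> Ob" and "metrizable_space X" and "separable_space X"
    and "Xbar \<in> Ob" and "compactification X Xbar e"
    and "k_space (gtop (F X))"
  shows "locally_compact_space X \<or> scattered_space X"
proof -
  obtain \<eta> \<theta> where "homeomorphic_maps J (top_of_set {0..1::real}) \<eta> \<theta>"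
    using assms(2) by (auto simp: homeomorphic_space_def)
  then have "test_maps (F X) (F J) X (i X) (\<lambda>t. i J (\<theta> t))"
    using minimal_free_topological_group_functor.test_maps assms(1,3,4) by blast
  then show ?thesis
    using assms(5,9) by (rule test_maps.locally_compact_or_scattered)
qed

end
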